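(* Let $\delta$ be a valley-free range map. As a unital associative algebra, $\mathbf{Cl}_\delta$ (i) is free if and only if $\delta$ is weakly increasing; (ii) admits a finite number of generators and a finite number of nontrivial relations between the generators (that is, admits a finite presentation) if and only if $\delta$ is $1$-dominated.
   Context: A range map is a map $\delta : \mathbb{N}\setminus\{0\} \to \mathbb{N}$ (with $0 \in \mathbb{N}$). It is valley-free if there are no $1 \leq i_1 < i_2 < i_3$ such that $\delta(i_1) > \delta(i_2) < \delta(i_3)$; weakly increasing if $\delta(i) \leq \delta(i+1)$ for all $i \geq 1$; and $1$-dominated if there is $k \geq 1$ such that for all $k' \geq k$, $\delta(1) \geq \delta(k')$. A $\delta$-cliff of size $n$ is a word $u = u_1 \cdots u_n$ of integers with $0 \leq u_i \leq \delta(i)$ for all $1 \leq i \leq n$; $\mathsf{Cl}_\delta(n)$ is the set of $\delta$-cliffs of size $n$ and $\mathsf{Cl}_\delta = \bigsqcup_{n\geq 0} \mathsf{Cl}_\delta(n)$. Let $\mathbb{K}$ be a field of characteristic zero. $\mathbf{Cl}_\delta$ is the $\mathbb{K}$-vector space with basis $\{\mathsf{F}_u : u \in \mathsf{Cl}_\delta\}$. For $n \geq 0$, $\mathrm{r}_\delta : \mathbb{N}^n \to \mathsf{Cl}_\delta(n)$ is defined by $\mathrm{r}_\delta(u)_i := \min\{u_i, \delta(i)\}$. The bilinear product of $\mathbf{Cl}_\delta$ is $$\mathsf{F}_u \cdot \mathsf{F}_v = \sum_{\substack{v' \in \mathrm{r}_\delta^{-1}(v)\\ uv' \in \mathsf{Cl}_\delta}}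 \mathsf{F}_{uv'},$$ where $uv'$ is the concatenation. This product is unital, and it is associative when $\delta$ is valley-free. *)

theory Defs
  imports "HOL-Algebra.RingHom" "HOL-Algebra.Module" "HOL-Library.Poly_Mapping"
begin

section \<open>Range maps and cliffs\<close>

text \<open>
  A range map is a function on the positive integers; it is represented by a function
  on \<open>nat\<close> whose value at \<open>0\<close> is never used.
\<close>

definition valley_free :: "(nat \<Rightarrow> nat) \<Rightarrow> bool" where
  "valley_free \<delta> \<longleftrightarrow>
     \<not> (\<exists>i1 i2 i3. 1 \<le> i1 \<and> i1 < i2 \<and> i2 < i3 \<and> \<delta> i1 > \<delta> i2 \<and> \<delta> i2 < \<delta> i3)"

definition weakly_increasing :: "(nat \<Rightarrow> nat) \<Rightarrow> bool" where
  "weakly_increasing \<delta> \<longleftrightarrow> (\<forall>i\<ge>1. \<delta> i \<le> \<delta> (i + 1))"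

definition one_dominated :: "(nat \<Rightarrow> nat) \<Rightarrow> bool" where
  "one_dominated \<delta> \<longleftrightarrow> (\<exists>k\<ge>1. \<forall>k'\<ge>k. \<delta> 1 \<ge> \<delta> k')"

text \<open>The letter \<open>u\<^sub>i\<close> of a word is the list entry \<open>u ! (i - 1)\<close>.\<close>

definition cliffs :: "(nat \<Rightarrow> nat) \<Rightarrow> nat list set" where
  "cliffs \<delta> = {u. \<forall>i\<in>{1..length u}. u ! (i - 1) \<le> \<delta> i}"

definition reduce_word :: "(nat \<Rightarrow> nat) \<Rightarrow> nat list \<Rightarrow> nat list" where
  "reduce_word \<delta> u = map (\<lambda>i. min (u ! (i - 1)) (\<delta> i)) [1..<length u + 1]"

section \<open>Algebras given by a product on a basis\<close>

text \<open>
  The vector space over the field \<open>'k\<close> with basis \<open>B\<close> consists of the finitely supported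
  functions with support in \<open>B\<close>; the basis element of \<open>b\<close> is \<open>Poly_Mapping.single b 1\<close>.
  Unital algebras are records of the type \<open>module\<close>, whose scalars here form the whole
  type \<open>'k\<close>; the locales \<open>module\<close> and \<open>algebra\<close> are not used, because the latter demands
  a commutative product.
\<close>

definition scale_pm :: "'k::field \<Rightarrow> ('b \<Rightarrow>\<^sub>0 'k) \<Rightarrow> ('b \<Rightarrow>\<^sub>0 'k)" where
  "scale_pm c p = Poly_Mapping.map ((*) c) p"

definition bilinear_ext ::
    "('b \<Rightarrow> 'b \<Rightarrow> ('b \<Rightarrow>\<^sub>0 'k)) \<Rightarrow> ('b \<Rightarrow>\<^sub>0 'k::field) \<Rightarrow> ('b \<Rightarrow>\<^sub>0 'k) \<Rightarrow> ('b \<Rightarrow>\<^sub>0 'k)" where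
  "bilinear_ext f p q =
     (\<Sum>u\<in>Poly_Mapping.keys p. \<Sum>v\<in>Poly_Mapping.keys q.
        scale_pm (Poly_Mapping.lookup p u * Poly_Mapping.lookup q v) (f u v))"

definition basis_algebra ::
    "'b set \<Rightarrow> ('b \<Rightarrow> 'b \<Rightarrow> ('b \<Rightarrow>\<^sub>0 'k)) \<Rightarrow> 'b \<Rightarrow> ('k::field, 'b \<Rightarrow>\<^sub>0 'k) module" where
  "basis_algebra B f e =
     \<lparr>carrier = {p. Poly_Mapping.keys p \<subseteq> B},
      monoid.mult = bilinear_ext f,
      monoid.one = Poly_Mapping.single e 1,
      ring.zero = 0,
      ring.add = (+),
      module.smult = scale_pm\<rparr>"

definition cliff_product ::
    "(nat \<Rightarrow> nat) \<Rightarrow> nat list \<Rightarrow> nat list \<Rightarrow> (nat list \<Rightarrow>\<^sub>0 'k::field)" where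
  "cliff_product \<delta> u v =
     (\<Sum>v' | reduce_word \<delta> v' = v \<and> u @ v' \<in> cliffs \<delta>. Poly_Mapping.single (u @ v') 1)"

definition cliff_algebra :: "(nat \<Rightarrow> nat) \<Rightarrow> ('k::field, nat list \<Rightarrow>\<^sub>0 'k) module" where
  "cliff_algebra \<delta> = basis_algebra (cliffs \<delta>) (cliff_product \<delta>) []"

definition free_algebra :: "'x set \<Rightarrow> ('k::field, 'x list \<Rightarrow>\<^sub>0 'k) module" where
  "free_algebra X = basis_algebra (lists X) (\<lambda>u v. Poly_Mapping.single (u @ v) 1) []"

section \<open>Free and finitely presented algebras\<close>

definition alg_hom :: "('k, 'a) module \<Rightarrow> ('k, 'b) module \<Rightarrow> ('a \<Rightarrow> 'b) set" where
  "alg_hom A B =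
     {h \<in> ring_hom A B. \<forall>c. \<forall>x\<in>carrier A. h (c \<odot>\<^bsub>A\<^esub> x) = c \<odot>\<^bsub>B\<^esub> h x}"

text \<open>
  Taking the set of free generators inside the type of the elements of \<open>A\<close> is no restriction,
  since free generators are mapped injectively into \<open>A\<close>.
\<close>

definition free_alg :: "('k::field, 'a) module \<Rightarrow> bool" where
  "free_alg A \<longleftrightarrow>
     (\<exists>(X :: 'a set) h. h \<in> alg_hom (free_algebra X) A \<and>
        bij_betw h (carrier (free_algebra X)) (carrier A))"

text \<open>
  The \<open>n\<close> generators are the images of the free generators in \<open>{..<n}\<close>, and \<open>R\<close> is a set of
  relations: it generates the kernel as an ideal, ideals in \<open>HOL-Algebra\<close> being two-sided.
\<close>

definition finitely_presented_alg :: "('k::field, 'a) module \<Rightarrow> bool" where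
  "finitely_presented_alg A \<longleftrightarrow>
     (\<exists>(n :: nat) h R. h \<in> alg_hom (free_algebra {..<n}) A \<and>
        h ` carrier (free_algebra {..<n}) = carrier A \<and>
        finite R \<and> R \<subseteq> carrier (free_algebra {..<n}) \<and>
        a_kernel (free_algebra {..<n}) A h = genideal (free_algebra {..<n}) R)"

section \<open>Well-definedness of the product\<close>

lemma length_reduce_word [simp]: "length (reduce_word \<delta> u) = length u"
  unfolding reduce_word_def length_map length_upt by simp

lemma finite_cliff_product_index:
  "finite {v'. reduce_word \<delta> v' = v \<and> u @ v' \<in> cliffs \<delta>}"
proof (rule finite_subset)
  let ?N = "Max (\<delta> ` {0..length u + length v})"
  show "{v'. reduce_word \<delta> v' = v \<and> u @ v' \<in> cliffs \<delta>}
        \<subseteq> {v'. set v' \<subseteq> {..?N} \<and> length v' = length v}"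
  proof (clarsimp simp: in_set_conv_nth)
    fix v' i assume c: "u @ v' \<in> cliffs \<delta>" and i: "i < length v'"
    have "(u @ v') ! (length u + i + 1 - 1) \<le> \<delta> (length u + i + 1)"
      using c i unfolding cliffs_def by (auto dest!: bspec[where x = "length u + i + 1"])
    also have "\<dots> \<le> Max (\<delta> ` {0..length u + length v'})"
      using i by (intro Max_ge) auto
    finally show "v' ! i \<le> Max (\<delta> ` {0..length u + length v'})"
      by simp
  qed
  show "finite {v'. set v' \<subseteq> {..?N} \<and> length v' = length v}"
    by (rule finite_lists_length_eq) simp
qed

lemma cliff_algebra_mult_basis:
  "Poly_Mapping.single u 1 \<otimes>\<^bsub>cliff_algebra \<delta>\<^esub> Poly_Mapping.single v (1 :: 'k::field) =
     (\<Sum>v' | reduce_word \<delta> v' = v \<and> u @ v' \<in> cliffs \<delta>. Poly_Mapping.single (u @ v') 1)"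
proof -
  have "scale_pm 1 p = p" for p :: "nat list \<Rightarrow>\<^sub>0 'k"
    unfolding scale_pm_def by (rule poly_mapping_eqI) (simp add: Poly_Mapping.map.rep_eq when_def)
  then show ?thesis
    by (simp add: cliff_algebra_def basis_algebra_def bilinear_ext_def cliff_product_def)
qed

end

theory Submission
  imports Defs
begin

text \<open>
  Write \<open>p(z)\<close> for the coefficient of \<open>p\<close> at the word \<open>z\<close>. Everything rests on the dual
  description of the product: to cut a cliff \<open>z\<close> after \<open>a\<close> letters and to reduce the right part
  gives
  \<open>(p q)(z) = (\<Sum>a \<le> length z. p (take a z) * q (reduce_word \<delta> (drop a z)))\<close>.
  The same formula, with no reduction, describes the free algebra, so both are treated
  as instances of one locale (\<open>word_cutting\<close>). Associativity becomes the fact that cutting twice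
  does not depend on the order of the cuts, and this is where the absence of valleys enters.

  Freeness. If \<open>\<delta> i > \<delta> (i + 1)\<close>, then without valleys \<open>\<delta>\<close> stays below \<open>\<delta> i\<close> after \<open>i\<close>, and
  the cliff \<open>0 \<dots> 0 \<delta>(i)\<close> of size \<open>i\<close> squares to zero (\<open>nilpotent_cliff\<close>), which cannot
  happen in a free algebra. If \<open>\<delta>\<close> is weakly increasing, then the cliffs are a submonoid of the
  free monoid of words, which is itself free on the cliffs that are not a concatenation of
  nonempty cliffs. A product of basis elements is the basis element of the concatenation
  plus terms whose letters have a larger sum (\<open>lookup_prod_cliffs\<close>). This triangularity carries
  the freeness of the monoid over to the algebra.

  Finite presentation. If \<open>\<delta>\<close> is not 1-dominated, then without valleys \<open>\<delta>\<close> equals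
  \<open>\<delta> 1\<close> up to some point and exceeds it from a position \<open>m\<close> on. For each \<open>N \<ge> m\<close> an alternating
  sum of the coefficients at size \<open>N\<close> is a derivation over the counit, hence
  vanishes on all products of elements without constant term, although it is nonzero in size
  \<open>N\<close> (\<open>alt_sum_mul\<close>). So generators of arbitrarily large size are needed.
  If \<open>\<delta>\<close> is 1-dominated, then it is constant,
  with a value \<open>c \<le> \<delta> 1\<close>, from some \<open>K\<close> on. Past size \<open>K\<close>, multiplication on the right by
  a one-letter cliff just appends the letter (\<open>mul_letter\<close>), so the nonempty cliffs of size at most
  \<open>K\<close> generate, and each cliff has a normal form: its prefix of size \<open>K\<close> followed by its
  remaining letters. The relations that put the product of two generators into normal form are
  finitely many. They put every word into normal form, since multiplication by a generator on the
  left only disturbs the prefix (\<open>gen_normal_word_cong\<close>).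
\<close>

section \<open>Linear extension\<close>

abbreviation lookup where "lookup \<equiv> Poly_Mapping.lookup"
abbreviation keys where "keys \<equiv> Poly_Mapping.keys"
abbreviation vec where "vec b \<equiv> Poly_Mapping.single b 1"

lemma lookup_scale_pm [simp]: "lookup (scale_pm c p) k = c * lookup p k"
  by (simp add: scale_pm_def Poly_Mapping.map.rep_eq when_def)

lemma scale_pm_one [simp]: "scale_pm 1 p = p"
  by (rule poly_mapping_eqI) simp

lemma scale_pm_zero [simp]: "scale_pm 0 p = 0" "scale_pm c 0 = 0"
  by (rule poly_mapping_eqI, simp)+

lemma scale_pm_add: "scale_pm c (p + q) = scale_pm c p + scale_pm c q"
  by (rule poly_mapping_eqI) (simp add: lookup_add algebra_simps)

lemma scale_pm_add_left: "scale_pm (c + d) p = scale_pm c p + scale_pm d p"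
  by (rule poly_mapping_eqI) (simp add: lookup_add algebra_simps)

lemma scale_pm_scale_pm [simp]: "scale_pm c (scale_pm d p) = scale_pm (c * d) p"
  by (rule poly_mapping_eqI) (simp add: mult.assoc)

lemma scale_pm_sum: "scale_pm c (sum g S) = (\<Sum>x\<in>S. scale_pm c (g x))"
  by (induction S rule: infinite_finite_induct) (simp_all add: scale_pm_add)

lemma uminus_eq_scale_pm: "- p = scale_pm (- 1) p"
  by (rule poly_mapping_eqI) simp

lemma keys_scale_pm: "keys (scale_pm c p) \<subseteq> keys p"
  by (auto simp: in_keys_iff)

lemma keys_add_subset: "keys p \<subseteq> B \<Longrightarrow> keys q \<subseteq> B \<Longrightarrow> keys (p + q) \<subseteq> B"
  using keys_add[of p q] by blast

lemma keys_diff_subset: "keys p \<subseteq> B \<Longrightarrow> keys q \<subseteq> B \<Longrightarrow> keys (p - q) \<subseteq> B"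
  using keys_diff[of p q] by blast

lemma basis_induct [consumes 1, case_names zero single add scale]:
  fixes p :: "'b \<Rightarrow>\<^sub>0 'k::field"
  assumes "keys p \<subseteq> B" "P 0" "\<And>b. b \<in> B \<Longrightarrow> P (vec b)"
    and "\<And>p q. keys p \<subseteq> B \<Longrightarrow> keys q \<subseteq> B \<Longrightarrow> P p \<Longrightarrow> P q \<Longrightarrow> P (p + q)"
    and "\<And>c p. keys p \<subseteq> B \<Longrightarrow> P p \<Longrightarrow> P (scale_pm c p)"
  shows "P p"
proof -
  have expand: "p = (\<Sum>b\<in>keys p. scale_pm (lookup p b) (vec b))"
    by (rule poly_mapping_eqI)
      (auto simp: lookup_sum lookup_single when_def sum.delta' in_keys_iff if_distrib cong: if_cong)
  have "finite S \<Longrightarrow> S \<subseteq> B \<Longrightarrow>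
      keys (\<Sum>b\<in>S. scale_pm (lookup p b) (vec b)) \<subseteq> B \<and>
      P (\<Sum>b\<in>S. scale_pm (lookup p b) (vec b))" for S
  proof (induction S rule: finite_induct)
    case (insert b S)
    have "keys (scale_pm (lookup p b) (vec b)) \<subseteq> B"
      using insert.prems keys_scale_pm by fastforce
    moreover have "P (scale_pm (lookup p b) (vec b))"
      using insert.prems by (intro assms) auto
    ultimately show ?case
      using insert by (simp add: keys_add_subset assms(4))
  qed (simp add: assms)
  from this[of "keys p"] show ?thesis
    using assms(1) expand by simp
qed

definition lin_ext :: "('b \<Rightarrow> ('c \<Rightarrow>\<^sub>0 'k::field)) \<Rightarrow> ('b \<Rightarrow>\<^sub>0 'k) \<Rightarrow> ('c \<Rightarrow>\<^sub>0 'k)" where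
  "lin_ext g p = (\<Sum>u\<in>keys p. scale_pm (lookup p u) (g u))"

lemma lin_ext_superset:
  "finite S \<Longrightarrow> keys p \<subseteq> S \<Longrightarrow> lin_ext g p = (\<Sum>u\<in>S. scale_pm (lookup p u) (g u))"
  unfolding lin_ext_def by (rule sum.mono_neutral_left) (auto simp: in_keys_iff)

lemma lin_ext_zero [simp]: "lin_ext g 0 = 0"
  by (simp add: lin_ext_def)

lemma lin_ext_single [simp]: "lin_ext g (vec u) = g u"
  by (simp add: lin_ext_def)

lemma lin_ext_add: "lin_ext g (p + q) = lin_ext g p + lin_ext g q"
  using keys_add[of p q]
  by (simp add: lin_ext_superset[of "keys p \<union> keys q"] lookup_add scale_pm_add_left sum.distrib)

lemma lin_ext_scale: "lin_ext g (scale_pm c p) = scale_pm c (lin_ext g p)"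
  by (simp add: lin_ext_superset[of "keys p"] keys_scale_pm scale_pm_sum)

lemma lin_ext_uminus: "lin_ext g (- p) = - lin_ext g p"
  by (simp add: uminus_eq_scale_pm lin_ext_scale)

lemma lin_ext_diff: "lin_ext g (p - q) = lin_ext g p - lin_ext g q"
  using lin_ext_add[of g p "- q"] by (simp add: lin_ext_uminus)

lemma lookup_lin_ext: "lookup (lin_ext g p) z = (\<Sum>u\<in>keys p. lookup p u * lookup (g u) z)"
  by (simp add: lin_ext_def lookup_sum)

lemma keys_lin_ext:
  assumes "\<And>u. u \<in> keys p \<Longrightarrow> keys (g u) \<subseteq> B"
  shows "keys (lin_ext g p) \<subseteq> B"
proof
  fix z assume "z \<in> keys (lin_ext g p)"
  then have "\<exists>u\<in>keys p. lookup p u * lookup (g u) z \<noteq> 0"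
    unfolding in_keys_iff lookup_lin_ext by (meson sum.neutral)
  then obtain u where "u \<in> keys p" "z \<in> keys (g u)"
    by (auto simp: in_keys_iff)
  with assms show "z \<in> B" by blast
qed

lemma bilinear_ext_eq: "bilinear_ext f p q = lin_ext (\<lambda>u. lin_ext (f u) q) p"
  by (simp add: bilinear_ext_def lin_ext_def scale_pm_sum)

lemma bilinear_ext_single [simp]:
  "bilinear_ext f (vec u) (vec v) = f u v"
  by (simp add: bilinear_ext_eq)

lemma bilinear_ext_zero [simp]: "bilinear_ext f 0 q = 0" "bilinear_ext f p 0 = 0"
  by (simp_all add: bilinear_ext_def)

lemma bilinear_ext_add_left:
  "bilinear_ext f (p + p') q = bilinear_ext f p q + bilinear_ext f p' q"
  by (simp add: bilinear_ext_eq lin_ext_add)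

lemma bilinear_ext_add_right:
  "bilinear_ext f p (q + q') = bilinear_ext f p q + bilinear_ext f p q'"
  unfolding bilinear_ext_eq lin_ext_add
  by (simp add: lin_ext_def scale_pm_add sum.distrib)

lemma bilinear_ext_scale_left: "bilinear_ext f (scale_pm c p) q = scale_pm c (bilinear_ext f p q)"
  by (simp add: bilinear_ext_eq lin_ext_scale)

lemma bilinear_ext_scale_right: "bilinear_ext f p (scale_pm c q) = scale_pm c (bilinear_ext f p q)"
  unfolding bilinear_ext_eq lin_ext_scale
  by (simp add: lin_ext_def scale_pm_sum mult.left_commute)

lemma bilinear_ext_diff_left:
  "bilinear_ext f (p - p') q = bilinear_ext f p q - bilinear_ext f p' q"
  using bilinear_ext_add_left[of f "p - p'" p' q] by simp

lemma bilinear_ext_diff_right: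
  "bilinear_ext f p (q - q') = bilinear_ext f p q - bilinear_ext f p q'"
  using bilinear_ext_add_right[of f p "q - q'" q'] by simp

lemma basis_algebra_sel [simp]:
  "carrier (basis_algebra B f e) = {p. keys p \<subseteq> B}"
  "p \<otimes>\<^bsub>basis_algebra B f e\<^esub> q = bilinear_ext f p q"
  "\<one>\<^bsub>basis_algebra B f e\<^esub> = vec e"
  "\<zero>\<^bsub>basis_algebra B f e\<^esub> = 0"
  "p \<oplus>\<^bsub>basis_algebra B f e\<^esub> q = p + q"
  "c \<odot>\<^bsub>basis_algebra B f e\<^esub> p = scale_pm c p"
  by (simp_all add: basis_algebra_def)

section \<open>Products dual to a cutting of words\<close>

text \<open>
  The product \<open>f u v\<close> is the sum of the words \<open>z\<close> of \<open>B\<close> that begin with \<open>u\<close> and whose remaining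
  part reduces to \<open>v\<close> under \<open>r\<close>. The two last assumptions are coassociativity of the dual
  operation, which cuts \<open>z\<close> into \<open>take a z\<close> and \<open>r (drop a z)\<close>: reduction commutes with taking
  prefixes, and a reduction made before a further cut leaves no trace after it.
\<close>

locale word_cutting =
  fixes B :: "'a list set" and r :: "'a list \<Rightarrow> 'a list"
    and f :: "'a list \<Rightarrow> 'a list \<Rightarrow> ('a list \<Rightarrow>\<^sub>0 'k::field)"
  assumes lookup_f: "u \<in> B \<Longrightarrow> v \<in> B \<Longrightarrow>
      lookup (f u v) z = (if z \<in> B \<and> (\<exists>v'. z = u @ v' \<and> r v' = v) then 1 else 0)"
    and Nil_in [simp]: "[] \<in> B"
    and length_r [simp]: "length (r u) = length u"
    and take_in: "z \<in> B \<Longrightarrow> take a z \<in> B"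
    and r_in: "z \<in> B \<Longrightarrow> r (drop a z) \<in> B"
    and r_id: "z \<in> B \<Longrightarrow> r z = z"
    and take_r: "z \<in> B \<Longrightarrow> take b (r (drop a z)) = r (take b (drop a z))"
    and drop_r: "z \<in> B \<Longrightarrow> r (drop b (r (drop a z))) = r (drop (a + b) z)"
begin

abbreviation (input) mul (infixl "\<star>" 70) where "p \<star> q \<equiv> bilinear_ext f p q"

lemma r_Nil [simp]: "r [] = []"
  using length_r[of "[]"] by (simp del: length_r)

lemma lookup_mul:
  assumes "keys p \<subseteq> B" "keys q \<subseteq> B"
  shows "lookup (p \<star> q) z =
    (if z \<in> B then \<Sum>a\<le>length z. lookup p (take a z) * lookup q (r (drop a z)) else 0)"
proof -
  have "lookup (p \<star> q) z =
      (\<Sum>u\<in>keys p. \<Sum>v\<in>keys q. lookup p u * lookup q v * lookup (f u v) z)"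
    by (simp add: bilinear_ext_def lookup_sum)
  also have "\<dots> = (if z \<in> B then \<Sum>a\<le>length z. lookup p (take a z) * lookup q (r (drop a z)) else 0)"
  proof (cases "z \<in> B")
    case False
    with assms show ?thesis
      by (auto intro!: sum.neutral simp: lookup_f subset_iff)
  next
    case True
    \<comment> \<open>Only the cut of \<open>z\<close> after \<open>length u\<close> letters can contribute, so the sum over all cuts
      counts the membership of \<open>z\<close> in the support of \<open>f u v\<close>.\<close>
    have cut: "lookup (f u v) z =
        (\<Sum>a\<le>length z. (if u = take a z then 1 else 0) * (if v = r (drop a z) then 1 else 0))"
      if "u \<in> B" "v \<in> B" for u v
    proof (cases "\<exists>v'. z = u @ v' \<and> r v' = v")
      case yes: True
      then obtain v' where v': "z = u @ v'" "r v' = v" by blast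
      have "(\<Sum>a\<le>length z. (if u = take a z then 1 else 0) * (if v = r (drop a z) then 1 else 0)) =
          (\<Sum>a\<in>{length u}. (1::'k))"
      proof (rule sum.mono_neutral_cong_right)
        show "\<forall>a\<in>{..length z} - {length u}.
           (if u = take a z then 1 else 0) * (if v = r (drop a z) then 1 else (0::'k)) = 0"
        proof
          fix a assume "a \<in> {..length z} - {length u}"
          then have "length (take a z) \<noteq> length u" by simp
          then have "u \<noteq> take a z" by metis
          then show "(if u = take a z then 1 else 0) * (if v = r (drop a z) then 1 else (0::'k)) = 0"
            by simp
        qed
      qed (auto simp: v')
      with that True yes show ?thesis by (simp add: lookup_f)
    next
      case no: False
      have "u \<noteq> take a z \<or> v \<noteq> r (drop a z)" for a
        using no append_take_drop_id[of a z] by metis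
      then have "(\<Sum>a\<le>length z. (if u = take a z then 1 else 0) * (if v = r (drop a z) then 1 else 0)) =
          (0::'k)"
        by (intro sum.neutral) auto
      with that True no show ?thesis by (simp add: lookup_f)
    qed
    have pick: "(\<Sum>u\<in>keys s. lookup s u * (if u = w then 1 else 0)) = lookup s w"
      for s :: "'a list \<Rightarrow>\<^sub>0 'k" and w
      by (simp add: if_distrib in_keys_iff cong: if_cong)
    have "(\<Sum>u\<in>keys p. \<Sum>v\<in>keys q. lookup p u * lookup q v * lookup (f u v) z) =
      (\<Sum>u\<in>keys p. \<Sum>v\<in>keys q. \<Sum>a\<le>length z. (lookup p u * (if u = take a z then 1 else 0)) *
          (lookup q v * (if v = r (drop a z) then 1 else 0)))"
      using assms by (intro sum.cong refl) (auto simp: cut sum_distrib_left subset_iff intro!: sum.cong)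
    also have "\<dots> = (\<Sum>u\<in>keys p. \<Sum>a\<le>length z. \<Sum>v\<in>keys q.
        (lookup p u * (if u = take a z then 1 else 0)) *
        (lookup q v * (if v = r (drop a z) then 1 else 0)))"
      by (intro sum.cong refl sum.swap)
    also have "\<dots> = (\<Sum>a\<le>length z. \<Sum>u\<in>keys p. \<Sum>v\<in>keys q.
        (lookup p u * (if u = take a z then 1 else 0)) *
        (lookup q v * (if v = r (drop a z) then 1 else 0)))"
      by (rule sum.swap)
    also have "\<dots> = (\<Sum>a\<le>length z. (\<Sum>u\<in>keys p. lookup p u * (if u = take a z then 1 else 0)) *
        (\<Sum>v\<in>keys q. lookup q v * (if v = r (drop a z) then 1 else 0)))"
      unfolding sum_product ..
    finally show ?thesis by (simp only: pick True if_True)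
  qed
  finally show ?thesis .
qed

lemma keys_mul:
  assumes "keys p \<subseteq> B" "keys q \<subseteq> B"
  shows "keys (p \<star> q) \<subseteq> B"
  using lookup_mul[OF assms] by (auto simp: in_keys_iff split: if_splits)

text \<open>
  Both sides are the sum over all ways to cut \<open>z\<close> into three pieces, the first one of length \<open>a\<close>
  and the second one of length \<open>c\<close>.
\<close>

lemma mul_assoc:
  assumes "keys p \<subseteq> B" "keys q \<subseteq> B" "keys s \<subseteq> B"
  shows "p \<star> q \<star> s = p \<star> (q \<star> s)"
proof (rule poly_mapping_eqI)
  fix z
  show "lookup (p \<star> q \<star> s) z = lookup (p \<star> (q \<star> s)) z"
  proof (cases "z \<in> B")
    case True
    define n where "n = length z"
    define g where "g a c = lookup p (take a z) * lookup q (r (take c (drop a z))) *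
      lookup s (r (drop (a + c) z))" for a c
    have "lookup (p \<star> q \<star> s) z = (\<Sum>b\<le>n. \<Sum>a\<le>b. g a (b - a))"
      using True assms
      by (auto simp: lookup_mul keys_mul take_in n_def g_def min_def sum_distrib_right drop_take
          intro!: sum.cong)
    also have "\<dots> = (\<Sum>(a, c) | a + c \<le> n. g a c)"
      by (subst sum.triangle_reindex_eq) simp
    also have "{(a, c). a + c \<le> n} = Sigma {..n} (\<lambda>a. {..n - a})"
      by auto
    also have "(\<Sum>(a, c)\<in>\<dots>. g a c) = (\<Sum>a\<le>n. \<Sum>c\<le>n - a. g a c)"
      by (rule sum.Sigma [symmetric]) auto
    also have "\<dots> = lookup (p \<star> (q \<star> s)) z"
      using True assms
      by (auto simp: lookup_mul keys_mul r_in n_def g_def sum_distrib_left take_r drop_r mult.assoc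
          intro!: sum.cong)
    finally show ?thesis .
  qed (use assms in \<open>simp add: lookup_mul keys_mul\<close>)
qed

lemma lookup_single_mul:
  assumes "u \<in> B" "keys q \<subseteq> B"
  shows "lookup (vec u \<star> q) z =
    (if z \<in> B \<and> take (length u) z = u then lookup q (r (drop (length u) z)) else 0)"
proof (cases "z \<in> B")
  case True
  have "(\<Sum>a\<le>length z. lookup (vec u) (take a z) * lookup q (r (drop a z))) =
    (\<Sum>a\<in>{length u} \<inter> {..length z}. lookup (vec u) (take a z) * lookup q (r (drop a z)))"
  proof (rule sum.mono_neutral_right)
    show "\<forall>i\<in>{..length z} - {length u} \<inter> {..length z}.
       lookup (vec u) (take i z) * lookup q (r (drop i z)) = 0"
      by (auto simp: lookup_single when_def)
  qed auto
  also have "\<dots> = (if take (length u) z = u then lookup q (r (drop (length u) z)) else 0)"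
    by (cases "length u \<le> length z") (auto simp: lookup_single when_def)
  finally show ?thesis
    using assms True by (simp add: lookup_mul)
qed (use assms in \<open>simp add: lookup_mul\<close>)

lemma one_mul: "keys q \<subseteq> B \<Longrightarrow> vec [] \<star> q = q"
  by (rule poly_mapping_eqI) (auto simp: lookup_single_mul r_id in_keys_iff)

lemma mul_one:
  assumes "keys p \<subseteq> B"
  shows "p \<star> vec [] = p"
proof (rule poly_mapping_eqI)
  fix z
  show "lookup (p \<star> vec []) z = lookup p z"
  proof (cases "z \<in> B")
    case True
    have "lookup (p \<star> vec []) z =
        (\<Sum>a\<le>length z. lookup p (take a z) * lookup (vec []) (r (drop a z)))"
      using assms True by (simp add: lookup_mul)
    also have "\<dots> = (\<Sum>a\<in>{length z}. lookup p (take a z) * lookup (vec []) (r (drop a z)))"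
    proof (rule sum.mono_neutral_right)
      show "\<forall>i\<in>{..length z} - {length z}.
         lookup p (take i z) * lookup (vec []) (r (drop i z)) = 0"
      proof
        fix i assume "i \<in> {..length z} - {length z}"
        then have "length (r (drop i z)) \<noteq> 0" by (simp only: length_r) auto
        then have "r (drop i z) \<noteq> []" by (metis list.size(3))
        then show "lookup p (take i z) * lookup (vec []) (r (drop i z)) = 0"
          by (simp add: lookup_single)
      qed
    qed auto
    finally show ?thesis by simp
  qed (use assms in \<open>auto simp: lookup_mul in_keys_iff\<close>)
qed

lemma ring_basis_algebra: "ring (basis_algebra B f [])"
proof (rule ringI)
  show "abelian_group (basis_algebra B f [])"
  proof (rule abelian_groupI)
    fix x assume "x \<in> carrier (basis_algebra B f [])"
    then show "\<exists>y\<in>carrier (basis_algebra B f []).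
        y \<oplus>\<^bsub>basis_algebra B f []\<^esub> x = \<zero>\<^bsub>basis_algebra B f []\<^esub>"
      by (intro bexI[of _ "- x"]) (auto simp: in_keys_iff subset_iff)
  qed (simp_all add: keys_add_subset add_ac)
  show "monoid (basis_algebra B f [])"
    by (rule monoidI) (simp_all add: keys_mul mul_assoc one_mul mul_one)
qed (simp_all add: bilinear_ext_add_left bilinear_ext_add_right)

primrec word_prod :: "('x \<Rightarrow> ('a list \<Rightarrow>\<^sub>0 'k)) \<Rightarrow> 'x list \<Rightarrow> ('a list \<Rightarrow>\<^sub>0 'k)" where
  "word_prod g [] = vec []"
| "word_prod g (x # xs) = g x \<star> word_prod g xs"

lemma keys_word_prod:
  "(\<And>x. x \<in> set xs \<Longrightarrow> keys (g x) \<subseteq> B) \<Longrightarrow> keys (word_prod g xs) \<subseteq> B"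
  by (induction xs) (simp_all add: keys_mul)

lemma word_prod_append:
  "(\<And>x. x \<in> set xs \<union> set ys \<Longrightarrow> keys (g x) \<subseteq> B) \<Longrightarrow>
    word_prod g (xs @ ys) = word_prod g xs \<star> word_prod g ys"
  by (induction xs) (simp_all add: one_mul keys_word_prod mul_assoc)

text \<open>
  The universal property of the free algebra, with the images of the generators given by \<open>g\<close>.
\<close>

lemma word_prod_hom:
  assumes "\<And>x. x \<in> X \<Longrightarrow> keys (g x) \<subseteq> B"
  shows "lin_ext (word_prod g) \<in> alg_hom (free_algebra X) (basis_algebra B f [])"
proof -
  let ?h = "lin_ext (word_prod g)"
  have mult: "?h (bilinear_ext (\<lambda>u v. vec (u @ v)) p q) = ?h p \<star> ?h q"
    if p: "keys p \<subseteq> lists X" and q: "keys q \<subseteq> lists X" for p q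
    using p
  proof (induction p rule: basis_induct)
    case (single u)
    from q show ?case
    proof (induction q rule: basis_induct)
      case (single v)
      with \<open>u \<in> lists X\<close> have "word_prod g (u @ v) = word_prod g u \<star> word_prod g v"
        by (intro word_prod_append assms) auto
      then show ?case by simp
    qed (simp_all add: bilinear_ext_add_right lin_ext_add bilinear_ext_scale_right lin_ext_scale)
  qed (simp_all add: bilinear_ext_add_left lin_ext_add bilinear_ext_scale_left lin_ext_scale)
  have closed: "keys (?h p) \<subseteq> B" if "keys p \<subseteq> lists X" for p
    using that assms by (intro keys_lin_ext keys_word_prod) auto
  show ?thesis
    unfolding alg_hom_def ring_hom_def free_algebra_def
    by (simp add: mult lin_ext_add lin_ext_scale closed Pi_iff)
qed

end

lemma word_cutting_lists:
  "word_cutting (lists X) (\<lambda>u. u) (\<lambda>u v. vec (u @ v) :: 'x list \<Rightarrow>\<^sub>0 'k::field)"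
  by unfold_locales
    (auto simp: lookup_single when_def take_drop add.commute dest: in_set_takeD in_set_dropD)

lemma ring_free_algebra: "ring (free_algebra X :: ('k::field, 'x list \<Rightarrow>\<^sub>0 'k) module)"
  unfolding free_algebra_def by (rule word_cutting.ring_basis_algebra [OF word_cutting_lists])

section \<open>The cliff algebra\<close>

lemma cliffs_iff: "u \<in> cliffs \<delta> \<longleftrightarrow> (\<forall>i<length u. u ! i \<le> \<delta> (Suc i))"
proof
  assume u: "u \<in> cliffs \<delta>"
  show "\<forall>i<length u. u ! i \<le> \<delta> (Suc i)"
  proof (intro allI impI)
    fix i assume "i < length u"
    then have "Suc i \<in> {1..length u}" by auto
    with u show "u ! i \<le> \<delta> (Suc i)" unfolding cliffs_def by fastforce
  qed
next
  assume *: "\<forall>i<length u. u ! i \<le> \<delta> (Suc i)"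
  have "u ! (i - 1) \<le> \<delta> i" if "i \<in> {1..length u}" for i
    using *[rule_format, of "i - 1"] that by auto
  then show "u \<in> cliffs \<delta>" unfolding cliffs_def by blast
qed

lemma nth_reduce_word [simp]:
  "i < length u \<Longrightarrow> reduce_word \<delta> u ! i = min (u ! i) (\<delta> (Suc i))"
  unfolding reduce_word_def by (simp del: upt_Suc)

lemma valley_freeD:
  "valley_free \<delta> \<Longrightarrow> 1 \<le> i \<Longrightarrow> i < j \<Longrightarrow> j < k \<Longrightarrow> min (\<delta> i) (\<delta> k) \<le> \<delta> j"
  unfolding valley_free_def by (meson min.coboundedI1 min.coboundedI2 not_le_imp_less)

text \<open>
  The assumption with content is the last one. A letter in position \<open>a + b + i\<close> of a cliff is at most
  \<open>\<delta> (a + b + i)\<close>; reducing it to \<open>\<delta> (b + i)\<close> before \<open>\<delta> i\<close> could lose information only if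
  \<open>\<delta> (b + i)\<close> were smaller than both \<open>\<delta> i\<close> and \<open>\<delta> (a + b + i)\<close>, which would be a valley.
\<close>

lemma word_cutting_cliffs:
  assumes "valley_free \<delta>"
  shows "word_cutting (cliffs \<delta>) (reduce_word \<delta>)
    (cliff_product \<delta> :: nat list \<Rightarrow> nat list \<Rightarrow> (nat list \<Rightarrow>\<^sub>0 'k::field))"
proof (unfold_locales, goal_cases)
  case (1 u v z)
  show "lookup (cliff_product \<delta> u v :: nat list \<Rightarrow>\<^sub>0 'k) z =
      (if z \<in> cliffs \<delta> \<and> (\<exists>v'. z = u @ v' \<and> reduce_word \<delta> v' = v) then 1 else 0)"
  proof (cases "z \<in> cliffs \<delta> \<and> (\<exists>v'. z = u @ v' \<and> reduce_word \<delta> v' = v)")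
    case True
    then obtain v' where v': "z \<in> cliffs \<delta>" "z = u @ v'" "reduce_word \<delta> v' = v" by blast
    have "lookup (cliff_product \<delta> u v :: nat list \<Rightarrow>\<^sub>0 'k) z =
        (\<Sum>x | reduce_word \<delta> x = v \<and> u @ x \<in> cliffs \<delta>. if x = v' then 1 else 0)"
      unfolding cliff_product_def lookup_sum
      by (intro sum.cong) (auto simp: lookup_single when_def v'(2))
    also have "\<dots> = 1"
      using v' finite_cliff_product_index[of \<delta> v u] by simp
    finally show ?thesis using True by simp
  next
    case False
    then have "lookup (cliff_product \<delta> u v :: nat list \<Rightarrow>\<^sub>0 'k) z = 0"
      unfolding cliff_product_def lookup_sum
      by (intro sum.neutral) (auto simp: lookup_single when_def)
    with False show ?thesis by simp
  qed
next
  case 2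
  show ?case by (simp add: cliffs_iff)
next
  case (3 u)
  show ?case by (rule length_reduce_word)
next
  case (4 z a)
  then show ?case by (simp add: cliffs_iff)
next
  case (5 z a)
  show ?case by (simp add: cliffs_iff)
next
  case (6 z)
  then show ?case by (intro nth_equalityI) (simp_all add: cliffs_iff)
next
  case (7 z b a)
  show ?case by (rule nth_equalityI) simp_all
next
  case (8 z b a)
  show "reduce_word \<delta> (drop b (reduce_word \<delta> (drop a z))) = reduce_word \<delta> (drop (a + b) z)"
  proof (rule nth_equalityI)
    fix i assume "i < length (reduce_word \<delta> (drop b (reduce_word \<delta> (drop a z))))"
    then have i: "a + b + i < length z" by simp
    then have le: "z ! (a + b + i) \<le> \<delta> (Suc (a + b + i))"
      using 8 by (simp add: cliffs_iff)
    have "min (\<delta> (Suc i)) (\<delta> (Suc (a + b + i))) \<le> \<delta> (Suc (b + i))"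
      using valley_freeD[OF assms, of "Suc i" "Suc (b + i)" "Suc (a + b + i)"]
      by (cases "a = 0"; cases "b = 0") auto
    with le have "min (min (z ! (a + b + i)) (\<delta> (Suc (b + i)))) (\<delta> (Suc i)) =
        min (z ! (a + b + i)) (\<delta> (Suc i))"
      by (auto simp: min_def split: if_splits)
    with i show "reduce_word \<delta> (drop b (reduce_word \<delta> (drop a z))) ! i =
        reduce_word \<delta> (drop (a + b) z) ! i"
      by (simp add: add.assoc)
  qed simp
qed

section \<open>Freeness\<close>

lemma vec_eq_iff [simp]: "(vec a :: 'b \<Rightarrow>\<^sub>0 'k::field) = vec b \<longleftrightarrow> a = b"
  by (metis lookup_single_eq lookup_single_not_eq zero_neq_one)

text \<open>
  If \<open>u\<close> and \<open>v\<close> are words of maximal length in \<open>p\<close> and \<open>q\<close>, then \<open>u @ v\<close> arises in the product in no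
  other way than from \<open>u\<close> and \<open>v\<close>.
\<close>

lemma free_algebra_no_zero_divisors:
  fixes p q :: "'x list \<Rightarrow>\<^sub>0 'k::field"
  assumes "bilinear_ext (\<lambda>u v. vec (u @ v)) p q = 0"
  shows "p = 0 \<or> q = 0"
proof (rule ccontr)
  assume "\<not> (p = 0 \<or> q = 0)"
  then have "keys p \<noteq> {}" "keys q \<noteq> {}" by auto
  then have "Max (length ` keys p) \<in> length ` keys p" "Max (length ` keys q) \<in> length ` keys q"
    by (intro Max_in; simp)+
  then obtain u v where u: "u \<in> keys p" "length u = Max (length ` keys p)"
    and v: "v \<in> keys q" "length v = Max (length ` keys q)" by auto
  have max: "lookup p w = 0" if "length w > length u" for w
    using that unfolding u(2) by (metis Max_ge finite_imageI finite_keys imageI in_keys_iff leD)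
  have max': "lookup q w = 0" if "length w > length v" for w
    using that unfolding v(2) by (metis Max_ge finite_imageI finite_keys imageI in_keys_iff leD)
  have "lookup (bilinear_ext (\<lambda>u v. vec (u @ v)) p q) (u @ v) =
      (\<Sum>a\<le>length (u @ v). lookup p (take a (u @ v)) * lookup q (drop a (u @ v)))"
    by (subst word_cutting.lookup_mul [OF word_cutting_lists, of _ UNIV]) auto
  also have "\<dots> = (\<Sum>a\<in>{length u}. lookup p (take a (u @ v)) * lookup q (drop a (u @ v)))"
  proof (rule sum.mono_neutral_right)
    show "\<forall>a\<in>{..length (u @ v)} - {length u}.
        lookup p (take a (u @ v)) * lookup q (drop a (u @ v)) = 0"
    proof
      fix a assume a: "a \<in> {..length (u @ v)} - {length u}"
      then consider "a < length u" | "length u < a" by fastforce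
      then show "lookup p (take a (u @ v)) * lookup q (drop a (u @ v)) = 0"
      proof cases
        case 1
        then show ?thesis using max'[of "drop a (u @ v)"] by simp
      next
        case 2
        then show ?thesis using a max[of "take a (u @ v)"] by simp
      qed
    qed
  qed auto
  finally have "lookup p u * lookup q v = 0" using assms by simp
  with u(1) v(1) show False by (simp add: in_keys_iff)
qed

lemma cliffs_nthD: "u \<in> cliffs \<delta> \<Longrightarrow> 1 \<le> i \<Longrightarrow> i \<le> length u \<Longrightarrow> u ! (i - 1) \<le> \<delta> i"
  by (simp add: cliffs_def)

text \<open>
  A word that reduces to \<open>u\<close> has a letter at least \<open>\<delta> i\<close> in position \<open>i\<close>. After \<open>u\<close>
  this letter stands in position \<open>2 * i\<close>, where only letters below \<open>\<delta> i\<close> are possible,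
  since \<open>\<delta>\<close> cannot rise again after its descent at \<open>i\<close>.
\<close>

lemma nilpotent_cliff:
  assumes vf: "valley_free \<delta>" and i: "1 \<le> i" "\<delta> (i + 1) < \<delta> i"
  defines "u \<equiv> replicate (i - 1) 0 @ [\<delta> i]"
  shows "u \<in> cliffs \<delta>" "cliff_product \<delta> u u = (0 :: nat list \<Rightarrow>\<^sub>0 'k::field)"
proof -
  show "u \<in> cliffs \<delta>"
    by (cases i) (use i(1) in \<open>auto simp: cliffs_iff u_def nth_append less_Suc_eq\<close>)
  have "\<not> (reduce_word \<delta> v = u \<and> u @ v \<in> cliffs \<delta>)" for v
  proof
    assume *: "reduce_word \<delta> v = u \<and> u @ v \<in> cliffs \<delta>"
    then have len: "length v = i" using i(1) by (metis Suc_pred' length_append length_reduce_word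
      length_replicate length_Cons list.size(3) u_def One_nat_def add.right_neutral add_Suc_right less_eq_Suc_le)
    then have "min (v ! (i - 1)) (\<delta> i) = reduce_word \<delta> v ! (i - 1)"
      using i(1) by simp
    also have "\<dots> = \<delta> i" using * by (simp add: u_def nth_append)
    finally have "\<delta> i \<le> v ! (i - 1)" by linarith
    moreover have "(u @ v) ! (i + i - 1) \<le> \<delta> (i + i)"
      using * len i(1) cliffs_nthD[of "u @ v" \<delta> "i + i"] by (simp add: u_def)
    moreover have "(u @ v) ! (i + i - 1) = v ! (i - 1)"
      using i(1) by (cases i) (simp_all add: u_def nth_append)
    moreover have "\<delta> (i + i) \<le> \<delta> (i + 1)"
      using valley_freeD[OF vf i(1), of "i + 1" "i + i"] i by (cases "i = 1") auto
    ultimately show False using i(2) by linarith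
  qed
  then show "cliff_product \<delta> u u = (0 :: nat list \<Rightarrow>\<^sub>0 'k::field)"
    unfolding cliff_product_def by (intro sum.neutral) blast
qed

lemma free_imp_weakly_increasing:
  assumes vf: "valley_free \<delta>"
    and free: "free_alg (cliff_algebra \<delta> :: ('k::field, nat list \<Rightarrow>\<^sub>0 'k) module)"
  shows "weakly_increasing \<delta>"
proof (rule ccontr)
  assume "\<not> weakly_increasing \<delta>"
  then obtain i where i: "1 \<le> i" "\<delta> (i + 1) < \<delta> i"
    unfolding weakly_increasing_def by (meson not_le)
  define u where "u = replicate (i - 1) 0 @ [\<delta> i]"
  let ?u = "vec u :: nat list \<Rightarrow>\<^sub>0 'k"
  note u = nilpotent_cliff[OF vf i, folded u_def]
  obtain X :: "(nat list \<Rightarrow>\<^sub>0 'k) set" and h where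
    h: "h \<in> alg_hom (free_algebra X) (cliff_algebra \<delta> :: ('k, nat list \<Rightarrow>\<^sub>0 'k) module)" and
    bij: "bij_betw h (carrier (free_algebra X)) (carrier (cliff_algebra \<delta>))"
    using free unfolding free_alg_def by blast
  note defs = free_algebra_def cliff_algebra_def
  have add: "h (p + q) = h p + h q" if "keys p \<subseteq> lists X" "keys q \<subseteq> lists X" for p q
    using h that unfolding alg_hom_def ring_hom_def defs by simp
  from add[of 0 0] have h0: "h 0 = 0" by simp
  have "?u \<in> carrier (cliff_algebra \<delta>)"
    using u(1) by (simp add: defs)
  then have "?u \<in> h ` carrier (free_algebra X)"
    unfolding bij_betw_imp_surj_on[OF bij] .
  then obtain p where p: "p \<in> carrier (free_algebra X)" "h p = ?u"
    by (elim imageE) simp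
  define pp where "pp = bilinear_ext (\<lambda>u v. vec (u @ v)) p p"
  have "h pp = 0"
    using h p u(2) unfolding alg_hom_def ring_hom_def defs pp_def by simp
  moreover have "pp \<in> carrier (free_algebra X)"
    using p(1) word_cutting.keys_mul[OF word_cutting_lists, of p X p] by (simp add: defs pp_def)
  moreover have "0 \<in> carrier (free_algebra X)" by (simp add: defs)
  ultimately have "pp = 0"
    using inj_onD[OF bij_betw_imp_inj_on[OF bij], of pp 0] h0 by simp
  then have "p = 0"
    using free_algebra_no_zero_divisors unfolding pp_def by blast
  with p(2) h0 have "lookup ?u u = 0" by simp
  then show False by simp
qed

definition prime_cliffs :: "(nat \<Rightarrow> nat) \<Rightarrow> nat list set" where
  "prime_cliffs \<delta> =
     {w \<in> cliffs \<delta>. w \<noteq> [] \<and> (\<forall>u v. w = u @ v \<longrightarrow> u \<noteq> [] \<longrightarrow> v \<noteq> [] \<longrightarrow> v \<notin> cliffs \<delta>)}"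

lemma cliffs_appendD: "u @ v \<in> cliffs \<delta> \<Longrightarrow> u \<in> cliffs \<delta>"
  by (auto simp: cliffs_iff nth_append split: if_splits)

lemma weakly_increasing_mono: "weakly_increasing \<delta> \<Longrightarrow> 1 \<le> i \<Longrightarrow> i \<le> j \<Longrightarrow> \<delta> i \<le> \<delta> j"
  by (rotate_tac 2, induction rule: dec_induct)
    (auto simp: weakly_increasing_def intro: order_trans)

lemma cliffs_appendI:
  assumes "weakly_increasing \<delta>" "u \<in> cliffs \<delta>" "v \<in> cliffs \<delta>"
  shows "u @ v \<in> cliffs \<delta>"
  unfolding cliffs_iff
proof (intro allI impI)
  fix i assume i: "i < length (u @ v)"
  show "(u @ v) ! i \<le> \<delta> (Suc i)"
  proof (cases "i < length u")
    case True
    then show ?thesis using assms(2) by (simp add: cliffs_iff nth_append)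
  next
    case False
    then have "v ! (i - length u) \<le> \<delta> (Suc (i - length u))"
      using assms(3) i by (simp add: cliffs_iff)
    also have "\<dots> \<le> \<delta> (Suc i)"
      using i False by (intro weakly_increasing_mono[OF assms(1)]) auto
    finally show ?thesis using False by (simp add: nth_append)
  qed
qed

lemma concat_cliffs:
  "weakly_increasing \<delta> \<Longrightarrow> ps \<in> lists (cliffs \<delta>) \<Longrightarrow> concat ps \<in> cliffs \<delta>"
  by (induction ps) (auto simp: cliffs_appendI, simp add: cliffs_iff)

lemma prime_factorization_exists:
  "w \<in> cliffs \<delta> \<Longrightarrow> \<exists>ps \<in> lists (prime_cliffs \<delta>). concat ps = w"
proof (induction "length w" arbitrary: w rule: less_induct)
  case less
  show ?case
  proof (cases "w = [] \<or> w \<in> prime_cliffs \<delta>")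
    case True
    then show ?thesis
      by (auto intro: bexI[of _ "[]"] bexI[of _ "[w]"])
  next
    case False
    then obtain u v where uv: "w = u @ v" "u \<noteq> []" "v \<noteq> []" "v \<in> cliffs \<delta>"
      using less.prems unfolding prime_cliffs_def by blast
    then obtain ps qs where "ps \<in> lists (prime_cliffs \<delta>)" "concat ps = u"
      "qs \<in> lists (prime_cliffs \<delta>)" "concat qs = v"
      using less.hyps[of u] less.hyps[of v] less.prems cliffs_appendD by auto
    then show ?thesis using uv(1) by (intro bexI[of _ "ps @ qs"]) auto
  qed
qed

lemma prime_cliffs_subset: "prime_cliffs \<delta> \<subseteq> cliffs \<delta>"
  by (auto simp: prime_cliffs_def)

text \<open>
  Of the first factors of two factorizations, one is a prefix of the other. What the longer has
  in excess is a prefix of a cliff, hence a cliff, and must be empty for the longer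
  factor to be prime.
\<close>

lemma prime_factorization_unique:
  assumes wi: "weakly_increasing \<delta>"
  shows "ps \<in> lists (prime_cliffs \<delta>) \<Longrightarrow> qs \<in> lists (prime_cliffs \<delta>) \<Longrightarrow>
    concat ps = concat qs \<Longrightarrow> ps = qs"
proof (induction ps arbitrary: qs)
  case Nil
  then show ?case by (cases qs) (auto simp: prime_cliffs_def)
next
  case (Cons p ps)
  from Cons.prems obtain q qs' where qs: "qs = q # qs'"
    by (cases qs) (auto simp: prime_cliffs_def)
  have tail: "concat rs \<in> cliffs \<delta>" if "rs \<in> lists (prime_cliffs \<delta>)" for rs
    using that prime_cliffs_subset by (intro concat_cliffs[OF wi]) (auto simp: subset_iff)
  have pq: "p \<in> prime_cliffs \<delta>" "q \<in> prime_cliffs \<delta>" "ps \<in> lists (prime_cliffs \<delta>)"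
    "qs' \<in> lists (prime_cliffs \<delta>)"
    using Cons.prems qs by auto
  obtain t where "p = q @ t \<and> t @ concat ps = concat qs' \<or> p @ t = q \<and> concat ps = t @ concat qs'"
    using Cons.prems(3) qs by (auto simp: append_eq_append_conv2)
  then have "t \<in> cliffs \<delta> \<and> (p = q @ t \<or> q = p @ t)"
    using tail[OF pq(3)] tail[OF pq(4)] by (metis cliffs_appendD)
  then have "t = []"
    using pq(1,2) unfolding prime_cliffs_def by blast
  with \<open>t \<in> cliffs \<delta> \<and> (p = q @ t \<or> q = p @ t)\<close> have "p = q" by auto
  with Cons qs show ?case by simp
qed

lemma sum_list_reduce_word:
  "reduce_word \<delta> w = w \<or> sum_list (reduce_word \<delta> w) < sum_list w"
proof (cases "\<forall>i<length w. w ! i \<le> \<delta> (Suc i)")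
  case True
  then show ?thesis by (auto intro!: nth_equalityI)
next
  case False
  then have "(\<Sum>i = 0..<length w. reduce_word \<delta> w ! i) < (\<Sum>i = 0..<length w. w ! i)"
    by (intro sum_strict_mono_ex1) (auto simp: not_le min_less_iff_disj intro!: bexI)
  then show ?thesis by (simp add: sum_list_sum_nth)
qed

context
  fixes \<delta> :: "nat \<Rightarrow> nat"
  assumes vf: "valley_free \<delta>"
begin

interpretation word_cutting "cliffs \<delta>" "reduce_word \<delta>"
  "cliff_product \<delta> :: nat list \<Rightarrow> nat list \<Rightarrow> (nat list \<Rightarrow>\<^sub>0 'k::field)"
  by (rule word_cutting_cliffs[OF vf])

text \<open>
  The triangularity of the products. Reduction can only decrease the sum of the letters, and it
  fixes a word only if it keeps this sum; so a term of a product has at least the sum of the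
  concatenation, with equality for the concatenation itself alone. The latter does occur, since it
  is a cliff when \<open>\<delta>\<close> is weakly increasing.
\<close>

lemma lookup_prod_cliffs:
  assumes wi: "weakly_increasing \<delta>" and ps: "ps \<in> lists (cliffs \<delta>)"
  defines "t \<equiv> word_prod (\<lambda>x. x) (map vec ps) :: nat list \<Rightarrow>\<^sub>0 'k::field"
  shows "lookup t (concat ps) = 1 \<and> (\<forall>z. lookup t z \<noteq> 0 \<longrightarrow> z = concat ps \<or>
      z \<in> cliffs \<delta> \<and> length z = length (concat ps) \<and> sum_list (concat ps) < sum_list z)"
  using ps unfolding t_def
proof (induction ps)
  case Nil
  then show ?case by (simp add: lookup_single when_def)
next
  case (Cons p ps)
  let ?t = "word_prod (\<lambda>x. x) (map vec ps) :: nat list \<Rightarrow>\<^sub>0 'k"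
  have p: "p \<in> cliffs \<delta>" "ps \<in> lists (cliffs \<delta>)"
    and IH1: "lookup ?t (concat ps) = 1"
    and IH2: "\<And>z. lookup ?t z \<noteq> 0 \<Longrightarrow> z = concat ps \<or>
      length z = length (concat ps) \<and> sum_list (concat ps) < sum_list z"
    using Cons by auto
  have keys: "keys ?t \<subseteq> cliffs \<delta>"
    using p by (intro keys_word_prod) auto
  have "concat ps \<in> cliffs \<delta>" "p @ concat ps \<in> cliffs \<delta>"
    using p by (auto intro!: concat_cliffs cliffs_appendI wi)
  then have "lookup (bilinear_ext (cliff_product \<delta>) (vec p) ?t) (p @ concat ps) = 1"
    using p IH1 keys by (simp add: lookup_single_mul r_id)
  moreover have "z = p @ concat ps \<or> z \<in> cliffs \<delta> \<and> length z = length (p @ concat ps) \<and>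
      sum_list (p @ concat ps) < sum_list z"
    if "lookup (bilinear_ext (cliff_product \<delta>) (vec p) ?t) z \<noteq> 0" for z
  proof -
    let ?y = "drop (length p) z"
    have z: "z \<in> cliffs \<delta>" "take (length p) z = p" "lookup ?t (reduce_word \<delta> ?y) \<noteq> 0"
      using that p keys by (auto simp: lookup_single_mul split: if_splits)
    note IH = IH2[OF z(3)]
    have zp: "z = p @ ?y" using z(2) by (metis append_take_drop_id)
    have len: "length ?y = length (concat ps)"
      using IH by (metis length_reduce_word)
    have lenz: "length z = length (p @ concat ps)"
      using arg_cong[OF zp, of length] len by (simp only: length_append)
    have sumz: "sum_list z = sum_list p + sum_list ?y"
      using arg_cong[OF zp, of sum_list] by (simp only: sum_list.append)
    show ?thesis
    proof (cases "?y = concat ps")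
      case True
      with zp show ?thesis by simp
    next
      case False
      then have "sum_list (concat ps) < sum_list ?y"
        using IH sum_list_reduce_word[of \<delta> ?y] by auto
      with sumz lenz z(1) show ?thesis by simp
    qed
  qed
  ultimately show ?case by simp
qed

lemma free_if_weakly_increasing:
  assumes wi: "weakly_increasing \<delta>"
  shows "free_alg (cliff_algebra \<delta> :: ('k::field, nat list \<Rightarrow>\<^sub>0 'k) module)"
proof -
  define X where "X = (vec ` prime_cliffs \<delta> :: (nat list \<Rightarrow>\<^sub>0 'k) set)"
  define g where "g = (word_prod (\<lambda>x. x) :: (nat list \<Rightarrow>\<^sub>0 'k) list \<Rightarrow> (nat list \<Rightarrow>\<^sub>0 'k))"
  define h where "h = lin_ext g"
  have X: "keys x \<subseteq> cliffs \<delta>" if "x \<in> X" for x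
    using that prime_cliffs_subset[of \<delta>] by (auto simp: X_def)
  have hom: "h \<in> alg_hom (free_algebra X) (cliff_algebra \<delta>)"
    unfolding h_def g_def cliff_algebra_def by (rule word_prod_hom) (rule X)
  have X_lists: "lists X = map vec ` lists (prime_cliffs \<delta>)"
    by (simp add: X_def lists_image)
  have lookup_g: "lookup (g (map vec ps)) (concat ps) = 1"
    "lookup (g (map vec ps)) z \<noteq> 0 \<Longrightarrow> z = concat ps \<or>
      z \<in> cliffs \<delta> \<and> length z = length (concat ps) \<and> sum_list (concat ps) < sum_list z"
    if "ps \<in> lists (prime_cliffs \<delta>)" for ps z
    using lookup_prod_cliffs[OF wi subsetD[OF lists_mono[OF prime_cliffs_subset] that]]
    unfolding g_def by blast+
  have inj: "p = 0" if "keys p \<subseteq> lists X" "h p = 0" for p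
  proof (rule ccontr)
    assume "p \<noteq> 0"
    \<comment> \<open>A word \<open>W\<close> in \<open>p\<close> whose leading cliff has the least sum: by triangularity no other word of
      \<open>p\<close> contributes to the coefficient of \<open>h p\<close> at this cliff.\<close>
    define m where "m W = sum_list (concat (map (inv_into UNIV vec) W))" for W :: "(nat list \<Rightarrow>\<^sub>0 'k) list"
    have "inv_into UNIV vec (vec q :: nat list \<Rightarrow>\<^sub>0 'k) = q" for q
      by (rule inv_f_f) (simp add: inj_def)
    then have m: "m (map vec ps) = sum_list (concat ps)" for ps
      by (simp add: m_def comp_def)
    from \<open>p \<noteq> 0\<close> have "keys p \<noteq> {}" by simp
    then have "Min (m ` keys p) \<in> m ` keys p" by simp
    then obtain W where W: "W \<in> keys p" and "Min (m ` keys p) = m W" by (elim imageE)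
    then have least: "m W \<le> m V" if "V \<in> keys p" for V
      using that by (metis Min_le finite_imageI finite_keys imageI)
    from W that(1) have "W \<in> map vec ` lists (prime_cliffs \<delta>)"
      unfolding X_lists by (rule subsetD [rotated])
    then obtain ps where ps: "W = map vec ps" "ps \<in> lists (prime_cliffs \<delta>)"
      by (elim imageE)
    have "lookup (h p) (concat ps) = (\<Sum>V\<in>keys p. lookup p V * lookup (g V) (concat ps))"
      by (simp add: h_def lookup_lin_ext)
    also have "\<dots> = (\<Sum>V\<in>{W}. lookup p V * lookup (g V) (concat ps))"
    proof (rule sum.mono_neutral_right)
      show "\<forall>V\<in>keys p - {W}. lookup p V * lookup (g V) (concat ps) = 0"
      proof
        fix V assume V: "V \<in> keys p - {W}"
        with that(1) have "V \<in> map vec ` lists (prime_cliffs \<delta>)"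
          unfolding X_lists by (meson DiffD1 subsetD)
        then obtain qs where qs: "V = map vec qs" "qs \<in> lists (prime_cliffs \<delta>)"
          by (elim imageE)
        have "concat ps \<noteq> concat qs"
          using prime_factorization_unique[OF wi ps(2) qs(2)] ps(1) qs(1) V by auto
        moreover have "\<not> sum_list (concat qs) < sum_list (concat ps)"
          using least[of V] V by (simp add: ps(1) qs(1) m)
        ultimately have "lookup (g V) (concat ps) = 0"
          using lookup_g(2)[OF qs(2)] qs(1) by blast
        then show "lookup p V * lookup (g V) (concat ps) = 0" by simp
      qed
    qed (use W in auto)
    also have "\<dots> = lookup p W"
      using lookup_g(1)[OF ps(2)] ps(1) by simp
    finally show False using W that(2) by (simp add: in_keys_iff)
  qed
  define V where "V = h ` {p. keys p \<subseteq> lists X}"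
  have V: "0 \<in> V" "\<And>p q. p \<in> V \<Longrightarrow> q \<in> V \<Longrightarrow> p + q \<in> V" "\<And>c p. p \<in> V \<Longrightarrow> scale_pm c p \<in> V"
  proof -
    show "0 \<in> V"
      unfolding V_def by (rule image_eqI[of _ _ 0]) (simp_all add: h_def)
    show "p + q \<in> V" if p: "p \<in> V" and q: "q \<in> V" for p q
    proof -
      obtain p' where p': "keys p' \<subseteq> lists X" "p = h p'"
        using p unfolding V_def by (elim imageE) simp
      obtain q' where q': "keys q' \<subseteq> lists X" "q = h q'"
        using q unfolding V_def by (elim imageE) simp
      have "p + q = h (p' + q')" by (simp only: p' q' h_def lin_ext_add)
      then show ?thesis
        unfolding V_def using keys_add_subset[OF p'(1) q'(1)] by (simp only: mem_Collect_eq imageI)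
    qed
    show "scale_pm c p \<in> V" if p: "p \<in> V" for c p
    proof -
      obtain p' where p': "keys p' \<subseteq> lists X" "p = h p'"
        using p unfolding V_def by (elim imageE) simp
      have "scale_pm c p = h (scale_pm c p')" by (simp only: p' h_def lin_ext_scale)
      then show ?thesis
        unfolding V_def using subset_trans[OF keys_scale_pm p'(1)]
        by (simp only: mem_Collect_eq imageI)
    qed
  qed
  have span: "p \<in> V" if "keys p \<subseteq> S" "\<And>b. b \<in> S \<Longrightarrow> vec b \<in> V" for p S
    using that by (induction p rule: basis_induct) (simp_all add: V)
  \<comment> \<open>Cliffs of a given size have bounded sum, so one can induct downwards on the sum: the basis
    element of \<open>w\<close> is the product of its prime factors minus terms with larger sum.\<close>
  have vec_V: "vec w \<in> V" if "w \<in> cliffs \<delta>" for w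
    using that
  proof (induction "(\<Sum>i<length w. \<delta> (Suc i)) - sum_list w" arbitrary: w rule: less_induct)
    case less
    obtain ps where ps: "ps \<in> lists (prime_cliffs \<delta>)" "concat ps = w"
      using prime_factorization_exists[OF less.prems] by blast
    define t where "t = g (map vec ps)"
    have "map vec ps \<in> lists X"
      unfolding X_lists using ps(1) by (rule imageI)
    then have "t \<in> V"
      unfolding V_def by (intro image_eqI[of _ _ "vec (map vec ps)"]) (simp_all add: h_def t_def)
    have "t - vec w \<in> V"
    proof (rule span)
      fix z assume "z \<in> keys (t - vec w)"
      then have z: "z \<noteq> w" "lookup t z \<noteq> 0"
        using lookup_g(1)[OF ps(1)] ps(2)
        by (auto simp: in_keys_iff lookup_minus lookup_single when_def t_def split: if_splits)
      then have *: "z \<in> cliffs \<delta>" "length z = length w" "sum_list w < sum_list z"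
        using lookup_g(2)[OF ps(1), of z] ps(2) by (auto simp: t_def)
      have "sum_list z \<le> (\<Sum>i<length z. \<delta> (Suc i))"
        using *(1) by (auto simp: cliffs_iff sum_list_sum_nth lessThan_atLeast0 intro!: sum_mono)
      then show "vec z \<in> V"
        using * by (intro less.hyps) auto
    qed simp
    then have "t + scale_pm (- 1) (t - vec w) \<in> V"
      using \<open>t \<in> V\<close> by (intro V)
    then show ?case by (simp add: uminus_eq_scale_pm[symmetric])
  qed
  have "bij_betw h (carrier (free_algebra X)) (carrier (cliff_algebra \<delta>))"
    unfolding bij_betw_def free_algebra_def cliff_algebra_def basis_algebra_sel
  proof
    show "inj_on h {p. keys p \<subseteq> lists X}"
    proof (rule inj_onI)
      fix p q assume "p \<in> {p. keys p \<subseteq> lists X}" "q \<in> {p. keys p \<subseteq> lists X}" "h p = h q"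
      then have "keys (p - q) \<subseteq> lists X" "h (p - q) = 0"
        using keys_diff[of p q] by (auto simp: h_def lin_ext_diff)
      then show "p = q" using inj by fastforce
    qed
    show "h ` {p. keys p \<subseteq> lists X} = {p. keys p \<subseteq> cliffs \<delta>}"
    proof
      show "h ` {p. keys p \<subseteq> lists X} \<subseteq> {p. keys p \<subseteq> cliffs \<delta>}"
        using hom unfolding alg_hom_def ring_hom_def free_algebra_def cliff_algebra_def by auto
      show "{p. keys p \<subseteq> cliffs \<delta>} \<subseteq> h ` {p. keys p \<subseteq> lists X}"
        using span[of _ "cliffs \<delta>"] vec_V unfolding V_def by blast
    qed
  qed
  with hom show ?thesis unfolding free_alg_def by blast
qed

end

section \<open>Infinitely many generators\<close>

text \<open>
  With \<open>d = \<delta> 1\<close>, these are cliffs when \<open>\<delta>\<close> exceeds \<open>d\<close> from position \<open>m\<close> on. The letters from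
  position \<open>m\<close> on can be toggled freely between \<open>d\<close> and \<open>Suc d\<close>; the zeros before only serve
  to fix one choice.
\<close>

definition step_words :: "nat \<Rightarrow> nat \<Rightarrow> nat \<Rightarrow> nat list set" where
  "step_words d m N =
     {z. length z = N \<and> (\<forall>i<N. if Suc i < m then z ! i = 0 else z ! i = d \<or> z ! i = Suc d)}"

definition alt_sum :: "nat \<Rightarrow> nat \<Rightarrow> nat \<Rightarrow> (nat list \<Rightarrow>\<^sub>0 'k::field) \<Rightarrow> 'k" where
  "alt_sum d m N p = (\<Sum>z\<in>step_words d m N. (- 1) ^ sum_list z * lookup p z)"

lemma finite_step_words: "finite (step_words d m N)"
proof (rule finite_subset)
  show "step_words d m N \<subseteq> {z. set z \<subseteq> {..Suc d} \<and> length z = N}"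
    by (force simp: step_words_def in_set_conv_nth split: if_splits)
qed (simp add: finite_lists_length_eq)

lemma alt_sum_add: "alt_sum d m N (p + q) = alt_sum d m N p + alt_sum d m N q"
  by (simp add: alt_sum_def lookup_add algebra_simps sum.distrib)

lemma alt_sum_scale: "alt_sum d m N (scale_pm c p) = c * alt_sum d m N p"
  by (simp add: alt_sum_def sum_distrib_left mult.left_commute)

text \<open>
  Toggling the letter at index \<open>j\<close> is an involution that keeps \<open>G\<close> and changes the sign.
\<close>

lemma alternating_sum_eq_0:
  fixes G :: "nat list \<Rightarrow> 'k::field_char_0"
  assumes j: "j < N" "m \<le> Suc j"
    and G: "\<And>z x. z \<in> step_words d m N \<Longrightarrow> x = d \<or> x = Suc d \<Longrightarrow> G (z[j := x]) = G z"
  shows "(\<Sum>z\<in>step_words d m N. (- 1) ^ sum_list z * G z) = 0"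
proof -
  define t where "t z = z[j := 2 * d + 1 - z ! j]" for z
  define S where "S = (\<Sum>z\<in>step_words d m N. (- 1) ^ sum_list z * G z)"
  have zj: "z ! j = d \<or> z ! j = Suc d" "length z = N" if "z \<in> step_words d m N" for z
    using that j unfolding step_words_def by force+
  have upd: "z[j := x] \<in> step_words d m N" if "z \<in> step_words d m N" "x = d \<or> x = Suc d" for z x
    using that j by (auto simp: step_words_def nth_list_update)
  have t: "t z \<in> step_words d m N" if "z \<in> step_words d m N" for z
    unfolding t_def using zj[OF that] by (intro upd that) auto
  have tt: "t (t z) = z" if "z \<in> step_words d m N" for z
  proof -
    have "2 * d + 1 - (2 * d + 1 - z ! j) = z ! j" using zj[OF that] by auto
    then show ?thesis using zj(2)[OF that] j by (simp add: t_def)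
  qed
  have flip: "(- 1) ^ sum_list (t z) * G (t z) = - ((- 1) ^ sum_list z * G z)"
    if z: "z \<in> step_words d m N" for z
  proof -
    have "G (t z) = G z"
      unfolding t_def by (rule G[OF z]) (use zj[OF z] in auto)
    moreover have "sum_list (t z) = Suc (sum_list z) \<or> sum_list z = Suc (sum_list (t z))"
    proof -
      have "z ! j \<le> sum_list z"
        using zj[OF z] j by (intro member_le_sum_list) auto
      moreover have "sum_list (t z) = sum_list z + (2 * d + 1 - z ! j) - z ! j"
        unfolding t_def using zj[OF z] j by (subst sum_list_update) auto
      ultimately show ?thesis
        using zj[OF z] by auto
    qed
    ultimately show ?thesis by auto
  qed
  have "S = (\<Sum>z\<in>step_words d m N. (- 1) ^ sum_list (t z) * G (t z))"
    unfolding S_def by (rule sum.reindex_bij_witness[of _ t t]) (simp_all add: t tt)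
  also have "\<dots> = - S"
    by (simp add: flip S_def sum_negf)
  finally have "2 * S = 0" by simp
  then show ?thesis by (simp add: S_def)
qed

lemma reduce_word_update:
  assumes "a \<le> j" "j < length z" "\<delta> (Suc (j - a)) \<le> z ! j" "\<delta> (Suc (j - a)) \<le> x"
  shows "reduce_word \<delta> (drop a (z[j := x])) = reduce_word \<delta> (drop a z)"
proof (rule nth_equalityI)
  fix i assume "i < length (reduce_word \<delta> (drop a (z[j := x])))"
  then have i: "a + i < length z" by simp
  then show "reduce_word \<delta> (drop a (z[j := x])) ! i = reduce_word \<delta> (drop a z) ! i"
    using assms by (cases "a + i = j") auto
qed simp

text \<open>
  The shape of a valley-free range map that is not 1-dominated.
\<close>

locale eventually_above =
  fixes \<delta> :: "nat \<Rightarrow> nat" and m :: nat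
  assumes vf: "valley_free \<delta>" and m: "2 \<le> m"
    and before: "1 \<le> i \<Longrightarrow> i < m \<Longrightarrow> \<delta> i = \<delta> 1"
    and after: "m \<le> i \<Longrightarrow> \<delta> 1 < \<delta> i"
begin

sublocale word_cutting "cliffs \<delta>" "reduce_word \<delta>"
  "cliff_product \<delta> :: nat list \<Rightarrow> nat list \<Rightarrow> (nat list \<Rightarrow>\<^sub>0 'k::field_char_0)"
  by (rule word_cutting_cliffs[OF vf])

lemma step_words_cliffs: "z \<in> step_words (\<delta> 1) m N \<Longrightarrow> z \<in> cliffs \<delta>"
  unfolding cliffs_iff
proof (intro allI impI)
  fix i assume "z \<in> step_words (\<delta> 1) m N" "i < length z"
  then show "z ! i \<le> \<delta> (Suc i)"
    using after[of "Suc i"] by (auto simp: step_words_def split: if_splits)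
qed

text \<open>
  Only the two trivial cuts contribute. For a cut after \<open>a\<close> letters with \<open>0 < a < N\<close> there is a
  position, \<open>m\<close> if \<open>a < m\<close> and \<open>a + 1\<close> otherwise, that can be toggled and whose position in
  the right part has the bound \<open>\<delta> 1\<close>. Reduction turns both \<open>\<delta> 1\<close> and \<open>Suc (\<delta> 1)\<close> into
  \<open>\<delta> 1\<close> there, so the contributions cancel in pairs.
\<close>

lemma alt_sum_mul:
  fixes p q :: "nat list \<Rightarrow>\<^sub>0 'k::field_char_0"
  assumes N: "m \<le> N" and p: "keys p \<subseteq> cliffs \<delta>" and q: "keys q \<subseteq> cliffs \<delta>"
  shows "alt_sum (\<delta> 1) m N (bilinear_ext (cliff_product \<delta>) p q) =
    lookup p [] * alt_sum (\<delta> 1) m N q + alt_sum (\<delta> 1) m N p * lookup q []"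
proof -
  let ?Z = "step_words (\<delta> 1) m N"
  define T where "T a = (\<Sum>z\<in>?Z. (- 1) ^ sum_list z *
    (lookup p (take a z) * lookup q (reduce_word \<delta> (drop a z))))" for a
  have Z: "length z = N" if "z \<in> ?Z" for z
    using that by (simp add: step_words_def)
  have "alt_sum (\<delta> 1) m N (bilinear_ext (cliff_product \<delta>) p q) = (\<Sum>z\<in>?Z. \<Sum>a\<le>N.
    (- 1) ^ sum_list z * (lookup p (take a z) * lookup q (reduce_word \<delta> (drop a z))))"
    unfolding alt_sum_def
    by (intro sum.cong refl) (simp add: lookup_mul[OF p q] step_words_cliffs Z sum_distrib_left)
  also have "\<dots> = (\<Sum>a\<le>N. T a)"
    unfolding T_def by (rule sum.swap)
  also have "\<dots> = (\<Sum>a\<in>{0, N}. T a)"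
  proof (rule sum.mono_neutral_right)
    show "\<forall>a\<in>{..N} - {0, N}. T a = 0"
    proof
      fix a assume "a \<in> {..N} - {0, N}"
      then have a: "0 < a" "a < N" by auto
      define j where "j = (if a < m then m - 1 else a)"
      have j: "j < N" "m \<le> Suc j" "a \<le> j" "\<delta> (Suc (j - a)) = \<delta> 1"
        using a N m before[of "m - a"] by (auto simp: j_def Suc_diff_Suc)
      show "T a = 0"
        unfolding T_def
      proof (rule alternating_sum_eq_0[OF j(1,2)])
        fix z x assume z: "z \<in> ?Z" and x: "x = \<delta> 1 \<or> x = Suc (\<delta> 1)"
        have "\<delta> 1 \<le> z ! j"
          using z j(1,2) by (auto simp: step_words_def split: if_splits)
        then show "lookup p (take a (z[j := x])) * lookup q (reduce_word \<delta> (drop a (z[j := x]))) =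
            lookup p (take a z) * lookup q (reduce_word \<delta> (drop a z))"
          using x j Z[OF z] by (subst reduce_word_update) auto
      qed
    qed
  qed auto
  also have "\<dots> = T 0 + T N"
    using N m by simp
  also have "T 0 = lookup p [] * alt_sum (\<delta> 1) m N q"
    unfolding T_def alt_sum_def sum_distrib_left
    by (intro sum.cong refl) (simp add: r_id step_words_cliffs)
  also have "T N = alt_sum (\<delta> 1) m N p * lookup q []"
    unfolding T_def alt_sum_def sum_distrib_right
    by (intro sum.cong refl) (simp add: Z)
  finally show ?thesis .
qed

text \<open>
  Finitely many generators have bounded size, so \<open>alt_sum (\<delta> 1) m N\<close> vanishes on them for large
  \<open>N\<close>. By \<open>alt_sum_mul\<close> it then vanishes on everything they generate, but not on the basis
  element of a single word of \<open>step_words (\<delta> 1) m N\<close>.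
\<close>

lemma not_finitely_generated:
  fixes h :: "(nat list \<Rightarrow>\<^sub>0 'k::field_char_0) \<Rightarrow> (nat list \<Rightarrow>\<^sub>0 'k)"
  assumes hom: "h \<in> alg_hom (free_algebra {..<n}) (cliff_algebra \<delta>)"
  shows "h ` carrier (free_algebra {..<n}) \<noteq> carrier (cliff_algebra \<delta>)"
proof
  assume surj: "h ` carrier (free_algebra {..<n}) = carrier (cliff_algebra \<delta>)"
  let ?L = "lists {..<n}"
  have keys: "keys (h p) \<subseteq> cliffs \<delta>" if "keys p \<subseteq> ?L" for p
    using hom that unfolding alg_hom_def ring_hom_def free_algebra_def cliff_algebra_def by auto
  have one: "h (vec []) = vec []"
    using hom unfolding alg_hom_def ring_hom_def free_algebra_def cliff_algebra_def by simp
  have add: "h (p + q) = h p + h q" if "keys p \<subseteq> ?L" "keys q \<subseteq> ?L" for p q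
    using hom that unfolding alg_hom_def ring_hom_def free_algebra_def cliff_algebra_def by simp
  have scale: "h (scale_pm c p) = scale_pm c (h p)" if "keys p \<subseteq> ?L" for c p
    using hom that unfolding alg_hom_def ring_hom_def free_algebra_def cliff_algebra_def by simp
  have mul: "h (bilinear_ext (\<lambda>u v. vec (u @ v)) p q) = bilinear_ext (cliff_product \<delta>) (h p) (h q)"
    if "keys p \<subseteq> ?L" "keys q \<subseteq> ?L" for p q
    using hom that unfolding alg_hom_def ring_hom_def free_algebra_def cliff_algebra_def by simp
  have "finite (\<Union>i<n. length ` keys (h (vec [i])))" by simp
  then obtain M where M: "\<forall>l\<in>(\<Union>i<n. length ` keys (h (vec [i]))). l < M"
    by (meson finite_nat_set_iff_bounded)
  define N where "N = M + m"
  let ?\<psi> = "alt_sum (\<delta> 1) m N :: (nat list \<Rightarrow>\<^sub>0 'k) \<Rightarrow> 'k"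
  have gen: "?\<psi> (h (vec [i])) = 0" if "i < n" for i
    unfolding alt_sum_def
  proof (rule sum.neutral, rule ballI)
    fix z assume z: "z \<in> step_words (\<delta> 1) m N"
    have "z \<notin> keys (h (vec [i]))"
    proof
      assume "z \<in> keys (h (vec [i]))"
      then have "length z < M" using M that by auto
      with z show False by (simp add: step_words_def N_def)
    qed
    then show "(- 1) ^ sum_list z * lookup (h (vec [i])) z = 0"
      by (simp add: in_keys_iff)
  qed
  have word: "?\<psi> (h (vec w)) = 0" if "w \<in> ?L" for w
    using that
  proof (induction w)
    case Nil
    have "[] \<notin> step_words (\<delta> 1) m N" using m by (simp add: step_words_def N_def)
    then show ?case
      unfolding one alt_sum_def by (intro sum.neutral ballI) (auto simp: lookup_single when_def)
  next
    case (Cons i w)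
    then have w: "i < n" "w \<in> ?L" "[i] \<in> ?L" by auto
    have "h (vec (i # w)) = bilinear_ext (cliff_product \<delta>) (h (vec [i])) (h (vec w))"
      using mul[of "vec [i]" "vec w"] w by simp
    then show ?case
      using alt_sum_mul[of N "h (vec [i])" "h (vec w)"] keys[of "vec [i]"] keys[of "vec w"]
        gen[OF w(1)] Cons.IH w by (simp add: N_def)
  qed
  have zero: "?\<psi> (h p) = 0" if "keys p \<subseteq> ?L" for p
    using that
  proof (induction p rule: basis_induct)
    case zero
    have "h 0 = 0" using add[of 0 0] by simp
    then show ?case by (simp add: alt_sum_def)
  next
    case (single w)
    then show ?case by (rule word)
  qed (simp_all add: add scale alt_sum_add alt_sum_scale)
  define z where "z = replicate (m - 1) 0 @ replicate (N - (m - 1)) (\<delta> 1)"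
  have z: "z \<in> step_words (\<delta> 1) m N"
    by (auto simp: z_def step_words_def nth_append N_def)
  then have "vec z \<in> carrier (cliff_algebra \<delta> :: ('k, nat list \<Rightarrow>\<^sub>0 'k) module)"
    by (simp add: cliff_algebra_def step_words_cliffs)
  then have "vec z \<in> h ` carrier (free_algebra {..<n})"
    unfolding surj .
  then obtain p where "keys p \<subseteq> ?L" "h p = vec z"
    by (elim imageE) (simp add: free_algebra_def)
  then have "?\<psi> (vec z) = 0" using zero by metis
  moreover have "?\<psi> (vec z) = (\<Sum>y\<in>{z}. (- 1) ^ sum_list y * lookup (vec z) y)"
    unfolding alt_sum_def using z finite_step_words
    by (intro sum.mono_neutral_right) (auto simp: lookup_single when_def)
  ultimately show False by simp
qed

end

lemma eventually_above_if_not_one_dominated: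
  assumes vf: "valley_free \<delta>" and nd: "\<not> one_dominated \<delta>"
  obtains m where "eventually_above \<delta> m"
proof -
  have large: "\<exists>k'\<ge>k. \<delta> 1 < \<delta> k'" for k
    using nd unfolding one_dominated_def by (metis le_trans max.cobounded1 max.cobounded2 not_le)
  define m where "m = (LEAST k. 1 \<le> k \<and> \<delta> 1 < \<delta> k)"
  have m: "1 \<le> m" "\<delta> 1 < \<delta> m"
    using LeastI_ex[of "\<lambda>k. 1 \<le> k \<and> \<delta> 1 < \<delta> k"] large[of 1] by (auto simp: m_def)
  have le: "\<delta> i \<le> \<delta> 1" if "1 \<le> i" "i < m" for i
    using not_less_Least[of i "\<lambda>k. 1 \<le> k \<and> \<delta> 1 < \<delta> k"] that by (auto simp: m_def)
  have "eventually_above \<delta> m"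
  proof
    show "2 \<le> m" using m by (cases "m = 1") auto
    show "\<delta> i = \<delta> 1" if "1 \<le> i" "i < m" for i
    proof (cases "i = 1")
      case False
      then show ?thesis
        using valley_freeD[OF vf, of 1 i m] that le[OF that] m(2) by auto
    qed simp
    show "\<delta> 1 < \<delta> i" if "m \<le> i" for i
    proof (rule ccontr)
      assume *: "\<not> \<delta> 1 < \<delta> i"
      obtain k where "i \<le> k" "\<delta> 1 < \<delta> k" using large by blast
      with * m that have "i < k" "m < i" by (metis le_neq_implies_less)+
      then show False
        using valley_freeD[OF vf m(1), of i k] * m(2) \<open>\<delta> 1 < \<delta> k\<close> by (auto simp: min_def split: if_splits)
    qed
  qed (rule vf)
  then show thesis by (rule that)
qed

lemma finitely_presented_imp_one_dominated:
  assumes "valley_free \<delta>"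
    and "finitely_presented_alg (cliff_algebra \<delta> :: ('k::field_char_0, nat list \<Rightarrow>\<^sub>0 'k) module)"
  shows "one_dominated \<delta>"
proof (rule ccontr)
  assume "\<not> one_dominated \<delta>"
  with assms(1) obtain m where "eventually_above \<delta> m"
    by (rule eventually_above_if_not_one_dominated)
  moreover obtain n :: nat and h where "h \<in> alg_hom (free_algebra {..<n})
      (cliff_algebra \<delta> :: ('k, nat list \<Rightarrow>\<^sub>0 'k) module)"
    "h ` carrier (free_algebra {..<n}) = carrier (cliff_algebra \<delta>)"
    using assms(2) unfolding finitely_presented_alg_def by blast
  ultimately show False
    using eventually_above.not_finitely_generated by metis
qed

section \<open>Finite presentation\<close>

abbreviation conc (infixl "\<diamondop>" 70) where
  "p \<diamondop> q \<equiv> bilinear_ext (\<lambda>u v. vec (u @ v)) p q"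

lemma conc_one: "vec [] \<diamondop> p = p" "p \<diamondop> vec [] = p"
  by (rule word_cutting.one_mul[OF word_cutting_lists, of _ UNIV]
      word_cutting.mul_one[OF word_cutting_lists, of _ UNIV]; simp)+

lemma keys_cliff_product:
  "z \<in> keys (cliff_product \<delta> u v :: nat list \<Rightarrow>\<^sub>0 'k::field) \<Longrightarrow>
    z \<in> cliffs \<delta> \<and> length z = length u + length v"
proof -
  assume "z \<in> keys (cliff_product \<delta> u v :: nat list \<Rightarrow>\<^sub>0 'k)"
  then have "\<exists>v'\<in>{v'. reduce_word \<delta> v' = v \<and> u @ v' \<in> cliffs \<delta>}.
      lookup (vec (u @ v') :: nat list \<Rightarrow>\<^sub>0 'k) z \<noteq> 0"
    unfolding in_keys_iff cliff_product_def lookup_sum by (meson sum.neutral)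
  then show ?thesis by (auto simp: lookup_single when_def split: if_splits)
qed

text \<open>
  The generators are the nonempty cliffs of size at most \<open>K\<close>; they are numbered by \<open>e\<close>, with inverse
  \<open>idx\<close>, because presentations have their generators in \<open>{..<n}\<close>.
\<close>

locale eventually_constant =
  fixes \<delta> :: "nat \<Rightarrow> nat" and K c n :: nat and e :: "nat \<Rightarrow> nat list" and idx :: "nat list \<Rightarrow> nat"
  assumes vf: "valley_free \<delta>" and K: "1 \<le> K"
    and const: "K \<le> j \<Longrightarrow> \<delta> j = c" and c: "c \<le> \<delta> 1"
    and e: "i < n \<Longrightarrow> e i \<in> cliffs \<delta> \<and> e i \<noteq> [] \<and> length (e i) \<le> K" "i < n \<Longrightarrow> idx (e i) = i"
    and idx: "u \<in> cliffs \<delta> \<Longrightarrow> u \<noteq> [] \<Longrightarrow> length u \<le> K \<Longrightarrow> idx u < n \<and> e (idx u) = u"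
begin

sublocale word_cutting "cliffs \<delta>" "reduce_word \<delta>"
  "cliff_product \<delta> :: nat list \<Rightarrow> nat list \<Rightarrow> (nat list \<Rightarrow>\<^sub>0 'k::field)"
  by (rule word_cutting_cliffs[OF vf])

abbreviation cliff_mul (infixl "\<star>" 70) where "p \<star> q \<equiv> bilinear_ext (cliff_product \<delta>) p q"

definition realize :: "(nat list \<Rightarrow>\<^sub>0 'k) \<Rightarrow> (nat list \<Rightarrow>\<^sub>0 'k::field)" where
  "realize = lin_ext (word_prod (\<lambda>i. vec (e i)))"

text \<open>
  The word in the generators that represents a cliff: one generator for the prefix of size \<open>K\<close>, then
  one generator for each further letter. A nonempty cliff of size at most \<open>K\<close> is a generator and
  represents itself.
\<close>

definition normal_word :: "nat list \<Rightarrow> nat list" where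
  "normal_word w = (if w = [] then [] else idx (take K w) # map (\<lambda>x. idx [x]) (drop K w))"

text \<open>
  A linear section of \<open>realize\<close>.
\<close>

definition lift :: "(nat list \<Rightarrow>\<^sub>0 'k) \<Rightarrow> (nat list \<Rightarrow>\<^sub>0 'k::field)" where
  "lift = lin_ext (\<lambda>w. vec (normal_word w))"

definition rel :: "nat \<Rightarrow> nat \<Rightarrow> (nat list \<Rightarrow>\<^sub>0 'k::field)" where
  "rel i j = vec [i, j] - lift (cliff_product \<delta> (e i) (e j))"

lemma realize_hom:
  "(realize :: (nat list \<Rightarrow>\<^sub>0 'k::field) \<Rightarrow> _) \<in> alg_hom (free_algebra {..<n}) (cliff_algebra \<delta>)"
  unfolding realize_def cliff_algebra_def by (rule word_prod_hom) (use e in auto)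

lemma keys_realize: "keys p \<subseteq> lists {..<n} \<Longrightarrow> keys (realize p :: nat list \<Rightarrow>\<^sub>0 'k::field) \<subseteq> cliffs \<delta>"
  using realize_hom[where 'k = 'k] unfolding alg_hom_def ring_hom_def free_algebra_def cliff_algebra_def
  by (simp add: Pi_iff)

lemma realize_conc:
  fixes p q :: "nat list \<Rightarrow>\<^sub>0 'k::field"
  shows "keys p \<subseteq> lists {..<n} \<Longrightarrow> keys q \<subseteq> lists {..<n} \<Longrightarrow> realize (p \<diamondop> q) = realize p \<star> realize q"
  using realize_hom[where 'k = 'k] unfolding alg_hom_def ring_hom_def free_algebra_def cliff_algebra_def by simp

lemma realize_gen: "i < n \<Longrightarrow> realize (vec [i] :: nat list \<Rightarrow>\<^sub>0 'k::field) = vec (e i)"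
  by (simp only: realize_def lin_ext_single word_prod.simps) (rule mul_one, use e in simp)

lemma append_cliffD:
  assumes "w @ [x] \<in> cliffs \<delta>"
  shows "w \<in> cliffs \<delta>" "x \<le> \<delta> (Suc (length w))"
  using assms cliffs_appendD cliffs_nthD[of "w @ [x]" \<delta> "Suc (length w)"] by auto

lemma letter_cliff: "x \<le> c \<Longrightarrow> [x] \<in> cliffs \<delta>"
  using c by (simp add: cliffs_iff)

text \<open>
  A letter that reduces to \<open>x\<close> is \<open>x\<close> itself, as positions from \<open>K\<close> on only admit letters up to
  \<open>c \<le> \<delta> 1\<close>.
\<close>

lemma mul_letter:
  assumes z: "z \<in> cliffs \<delta>" "K \<le> length z" and x: "x \<le> c"
  shows "cliff_product \<delta> z [x] = (vec (z @ [x]) :: nat list \<Rightarrow>\<^sub>0 'k::field)"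
proof -
  have "{v'. reduce_word \<delta> v' = [x] \<and> z @ v' \<in> cliffs \<delta>} = {[x]}"
  proof (intro equalityI subsetI)
    fix v assume "v \<in> {v'. reduce_word \<delta> v' = [x] \<and> z @ v' \<in> cliffs \<delta>}"
    then have v: "reduce_word \<delta> v = [x]" "z @ v \<in> cliffs \<delta>" by auto
    have "length v = 1" using arg_cong[OF v(1), of length] by simp
    then obtain y where y: "v = [y]" by (auto simp: length_Suc_conv)
    have "y \<le> c"
      using append_cliffD(2)[of z y] v(2) y const[of "Suc (length z)"] z(2) by simp
    moreover have "reduce_word \<delta> v ! 0 = min y (\<delta> 1)" using y by simp
    ultimately have "x = y" using v(1) c by simp
    with y show "v \<in> {[x]}" by simp
  next
    fix v assume "v \<in> {[x]}"
    moreover have "reduce_word \<delta> [x] = [x]"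
      using letter_cliff[OF x] by (rule r_id)
    moreover have "z @ [x] \<in> cliffs \<delta>"
      using z x const[of "Suc (length z)"] by (auto simp: cliffs_iff nth_append less_Suc_eq)
    ultimately show "v \<in> {v'. reduce_word \<delta> v' = [x] \<and> z @ v' \<in> cliffs \<delta>}" by simp
  qed
  then show ?thesis by (simp add: cliff_product_def)
qed

lemma normal_word_Nil [simp]: "normal_word [] = []"
  by (simp add: normal_word_def)

lemma normal_word_short: "w \<noteq> [] \<Longrightarrow> length w \<le> K \<Longrightarrow> normal_word w = [idx w]"
  by (simp add: normal_word_def)

lemma normal_word_snoc: "K \<le> length z \<Longrightarrow> normal_word (z @ [x]) = normal_word z @ [idx [x]]"
  using K by (auto simp: normal_word_def)

lemma cliff_cases [case_names Nil short snoc]: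
  assumes "w \<in> cliffs \<delta>"
  obtains "w = []" | "w \<noteq> []" "length w \<le> K"
  | z x where "w = z @ [x]" "z \<in> cliffs \<delta>" "K \<le> length z" "x \<le> c"
proof (cases "length w \<le> K")
  case False
  then obtain z x where w: "w = z @ [x]" by (cases w rule: rev_cases) auto
  with False have "K \<le> length z" by simp
  moreover from this have "x \<le> c"
    using append_cliffD(2)[of z x] assms w const[of "Suc (length z)"] by simp
  ultimately show thesis using w assms append_cliffD(1) that(3) by blast
qed (use that in blast)

lemma idx_letter: "x \<le> c \<Longrightarrow> idx [x] < n \<and> e (idx [x]) = [x]"
  using idx letter_cliff K by simp

lemma normal_word_in_lists: "w \<in> cliffs \<delta> \<Longrightarrow> normal_word w \<in> lists {..<n}"
proof (induction w rule: measure_induct_rule[of length])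
  case (less w)
  from less.prems show ?case
  proof (cases w rule: cliff_cases)
    case short
    then show ?thesis using idx less.prems by (simp add: normal_word_short)
  next
    case (snoc z x)
    then show ?thesis using less.IH[of z] idx_letter by (simp add: normal_word_snoc)
  qed simp
qed

lemma realize_normal_word: "w \<in> cliffs \<delta> \<Longrightarrow> realize (vec (normal_word w) :: nat list \<Rightarrow>\<^sub>0 'k::field) = vec w"
proof (induction w rule: measure_induct_rule[of length])
  case (less w)
  from less.prems show ?case
  proof (cases w rule: cliff_cases)
    case Nil
    then show ?thesis by (simp add: realize_def)
  next
    case short
    then show ?thesis using idx less.prems by (simp add: normal_word_short realize_gen)
  next
    case (snoc z x)
    have "realize (vec (normal_word w) :: nat list \<Rightarrow>\<^sub>0 'k) = realize (vec (normal_word z) \<diamondop> vec [idx [x]])"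
      using snoc by (simp add: normal_word_snoc)
    also have "\<dots> = realize (vec (normal_word z)) \<star> realize (vec [idx [x]])"
      using snoc normal_word_in_lists[of z] idx_letter[of x] by (intro realize_conc) simp_all
    also have "\<dots> = vec z \<star> vec [x]"
      using snoc less.IH[of z] idx_letter[of x] by (simp add: realize_gen)
    finally show ?thesis using snoc by (simp add: mul_letter)
  qed
qed

lemma keys_lift: "keys p \<subseteq> cliffs \<delta> \<Longrightarrow> keys (lift p :: nat list \<Rightarrow>\<^sub>0 'k::field) \<subseteq> lists {..<n}"
  unfolding lift_def using normal_word_in_lists by (intro keys_lin_ext) auto

lemma realize_lift: "keys p \<subseteq> cliffs \<delta> \<Longrightarrow> realize (lift p :: nat list \<Rightarrow>\<^sub>0 'k::field) = p"
proof (induction p rule: basis_induct)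
  case (single w)
  then show ?case using realize_normal_word by (simp add: lift_def)
qed (simp_all add: lift_def realize_def lin_ext_add lin_ext_scale)

lemma lift_mul_letter:
  assumes "keys p \<subseteq> {z \<in> cliffs \<delta>. K \<le> length z}" and x: "x \<le> c"
  shows "lift (p \<star> vec [x]) = (lift p \<diamondop> vec [idx [x]] :: nat list \<Rightarrow>\<^sub>0 'k::field)"
  using assms(1)
proof (induction p rule: basis_induct)
  case (single z)
  then show ?case using x by (simp add: lift_def mul_letter normal_word_snoc)
qed (simp_all add: lift_def bilinear_ext_add_left lin_ext_add bilinear_ext_scale_left lin_ext_scale)

context
  fixes I :: "(nat list \<Rightarrow>\<^sub>0 'k::field) set"
  assumes I: "ideal I (free_algebra {..<n})" and rel: "\<And>i j. i < n \<Longrightarrow> j < n \<Longrightarrow> rel i j \<in> I"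
begin

lemma I_add: "p \<in> I \<Longrightarrow> q \<in> I \<Longrightarrow> p + q \<in> I"
  using additive_subgroup.a_closed[OF ideal.axioms(1)[OF I]] by (simp add: free_algebra_def)

lemma I_zero: "0 \<in> I"
  using additive_subgroup.zero_closed[OF ideal.axioms(1)[OF I]] by (simp add: free_algebra_def)

lemma I_conc_left: "p \<in> I \<Longrightarrow> keys q \<subseteq> lists {..<n} \<Longrightarrow> q \<diamondop> p \<in> I"
  using ideal.I_l_closed[OF I] by (simp add: free_algebra_def)

lemma I_conc_right: "p \<in> I \<Longrightarrow> keys q \<subseteq> lists {..<n} \<Longrightarrow> p \<diamondop> q \<in> I"
  using ideal.I_r_closed[OF I] by (simp add: free_algebra_def)

lemma I_scale: "p \<in> I \<Longrightarrow> scale_pm a p \<in> I"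
proof -
  assume p: "p \<in> I"
  have "keys (scale_pm a (vec []) :: nat list \<Rightarrow>\<^sub>0 'k) \<subseteq> lists {..<n}"
    by (rule subset_trans[OF keys_scale_pm]) simp
  from I_conc_left[OF p this] show ?thesis
    by (simp add: bilinear_ext_scale_left conc_one)
qed

text \<open>
  For \<open>w\<close> of size at most \<open>K\<close> this is one of the relations. A further letter is appended on the right,
  both to the word in the generators and to all terms of the product, so it is multiplied
  onto the congruence already known. Working from the left is essential here: multiplied
  on the right, a generator meets the tail of the normal word, and the relations that apply there
  lead away from normal words.
\<close>

lemma gen_normal_word_cong:
  assumes i: "i < n"
  shows "w \<in> cliffs \<delta> \<Longrightarrow> vec (i # normal_word w) - lift (cliff_product \<delta> (e i) w) \<in> I"
proof (induction w rule: measure_induct_rule[of length])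
  case (less w)
  from less.prems show ?case
  proof (cases w rule: cliff_cases)
    case Nil
    have "cliff_product \<delta> (e i) [] = (vec (e i) \<star> vec [] :: nat list \<Rightarrow>\<^sub>0 'k)" by simp
    also have "\<dots> = vec (e i)" using e[OF i] by (intro mul_one) simp
    finally show ?thesis using Nil e[OF i] I_zero by (simp add: lift_def normal_word_short)
  next
    case short
    then show ?thesis
      using rel[OF i, of "idx w"] idx less.prems by (simp add: rel_def normal_word_short)
  next
    case (snoc z x)
    have x: "keys (vec [idx [x]] :: nat list \<Rightarrow>\<^sub>0 'k) \<subseteq> lists {..<n}"
      using idx_letter snoc by simp
    let ?p = "cliff_product \<delta> (e i) z :: nat list \<Rightarrow>\<^sub>0 'k"
    have "cliff_product \<delta> (e i) w = (vec (e i) \<star> vec w :: nat list \<Rightarrow>\<^sub>0 'k)" by simp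
    also have "\<dots> = vec (e i) \<star> (vec z \<star> vec [x])"
      using snoc by (simp add: mul_letter)
    also have "\<dots> = vec (e i) \<star> vec z \<star> vec [x]"
      using snoc e[OF i] letter_cliff by (intro mul_assoc[symmetric]) simp_all
    finally have "lift (cliff_product \<delta> (e i) w) = lift (?p \<star> vec [x])" by simp
    also have "\<dots> = lift ?p \<diamondop> vec [idx [x]]"
      using snoc keys_cliff_product[of _ \<delta> "e i" z] by (intro lift_mul_letter) fastforce+
    finally have "vec (i # normal_word w) - lift (cliff_product \<delta> (e i) w) =
        (vec (i # normal_word z) - lift ?p) \<diamondop> vec [idx [x]]"
      using snoc by (simp add: bilinear_ext_diff_left normal_word_snoc)
    moreover have "vec (i # normal_word z) - lift ?p \<in> I"
      using less.IH[of z] snoc by simp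
    ultimately show ?thesis using I_conc_right x by simp
  qed
qed

lemma gen_lift_cong:
  assumes i: "i < n" and "keys p \<subseteq> cliffs \<delta>"
  shows "vec [i] \<diamondop> lift p - lift (vec (e i) \<star> p) \<in> I"
  using assms(2)
proof (induction p rule: basis_induct)
  case zero
  then show ?case by (simp add: lift_def I_zero)
next
  case (single w)
  then show ?case using gen_normal_word_cong[OF i] by (simp add: lift_def)
next
  case (add p q)
  have "vec [i] \<diamondop> lift (p + q) - lift (vec (e i) \<star> (p + q)) =
      (vec [i] \<diamondop> lift p - lift (vec (e i) \<star> p)) + (vec [i] \<diamondop> lift q - lift (vec (e i) \<star> q))"
    by (simp add: lift_def bilinear_ext_add_right lin_ext_add)
  then show ?case using add I_add by simp
next
  case (scale a p)
  have "vec [i] \<diamondop> lift (scale_pm a p) - lift (vec (e i) \<star> scale_pm a p) =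
      scale_pm a (vec [i] \<diamondop> lift p - lift (vec (e i) \<star> p))"
    by (rule poly_mapping_eqI)
      (simp add: lift_def bilinear_ext_scale_right lin_ext_scale lookup_minus algebra_simps)
  then show ?case using scale I_scale by simp
qed

lemma word_cong: "w \<in> lists {..<n} \<Longrightarrow> vec w - lift (realize (vec w)) \<in> I"
proof (induction w)
  case Nil
  show ?case by (simp add: lift_def realize_def I_zero)
next
  case (Cons i w)
  then have i: "i < n" and w: "keys (vec w :: nat list \<Rightarrow>\<^sub>0 'k) \<subseteq> lists {..<n}"
    and IH: "vec w - lift (realize (vec w)) \<in> I"
    by auto
  have "realize (vec (i # w) :: nat list \<Rightarrow>\<^sub>0 'k) = vec (e i) \<star> realize (vec w)"
    using realize_conc[of "vec [i]" "vec w"] i w by (simp add: realize_gen)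
  then have "(vec (i # w) :: nat list \<Rightarrow>\<^sub>0 'k) - lift (realize (vec (i # w))) =
      vec [i] \<diamondop> (vec w - lift (realize (vec w))) +
      (vec [i] \<diamondop> lift (realize (vec w)) - lift (vec (e i) \<star> realize (vec w)))"
    by (simp add: bilinear_ext_diff_right)
  moreover have "vec [i] \<diamondop> (vec w - lift (realize (vec w))) \<in> I"
    using i by (intro I_conc_left IH) simp
  moreover have "vec [i] \<diamondop> lift (realize (vec w)) - lift (vec (e i) \<star> realize (vec w)) \<in> I"
    using i w by (intro gen_lift_cong keys_realize)
  ultimately show ?case using I_add by simp
qed

lemma lift_realize_cong: "keys p \<subseteq> lists {..<n} \<Longrightarrow> p - lift (realize p) \<in> I"
proof (induction p rule: basis_induct)
  case zero
  then show ?case by (simp add: lift_def realize_def I_zero)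
next
  case (single w)
  then show ?case by (rule word_cong)
next
  case (add p q)
  have "p + q - lift (realize (p + q)) = (p - lift (realize p)) + (q - lift (realize q))"
    by (simp add: lift_def realize_def lin_ext_add)
  then show ?case using I_add[OF add.IH] by (simp only:)
next
  case (scale a p)
  have "scale_pm a p - lift (realize (scale_pm a p)) = scale_pm a (p - lift (realize p))"
    by (rule poly_mapping_eqI)
      (simp add: lift_def realize_def lin_ext_scale lookup_minus algebra_simps)
  then show ?case using scale I_scale by simp
qed

end

text \<open>
  If \<open>p\<close> is in the kernel, then \<open>p = p - lift (realize p)\<close> lies in the ideal of the relations by
  \<open>lift_realize_cong\<close>.
\<close>

lemma finitely_presented:
  "finitely_presented_alg (cliff_algebra \<delta> :: ('k::field, nat list \<Rightarrow>\<^sub>0 'k) module)"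
proof -
  let ?F = "free_algebra {..<n} :: ('k, nat list \<Rightarrow>\<^sub>0 'k) module"
  let ?A = "cliff_algebra \<delta> :: ('k, nat list \<Rightarrow>\<^sub>0 'k) module"
  define R where "R = (\<lambda>(i, j). rel i j :: nat list \<Rightarrow>\<^sub>0 'k) ` ({..<n} \<times> {..<n})"
  have F: "ring ?F" by (rule ring_free_algebra)
  have A: "ring ?A" unfolding cliff_algebra_def by (rule ring_basis_algebra)
  have cp: "keys (cliff_product \<delta> (e i) (e j) :: nat list \<Rightarrow>\<^sub>0 'k) \<subseteq> cliffs \<delta>" for i j
    using keys_cliff_product by blast
  have rel_keys: "keys (rel i j :: nat list \<Rightarrow>\<^sub>0 'k) \<subseteq> lists {..<n}" if "i < n" "j < n" for i j
    unfolding rel_def using that by (intro keys_diff_subset keys_lift cp) simp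
  have R: "R \<subseteq> carrier ?F" unfolding R_def free_algebra_def using rel_keys by auto
  have hom: "ring_hom_ring ?F ?A realize"
    using F A realize_hom unfolding alg_hom_def by (intro ring_hom_ringI2) auto
  have ker: "a_kernel ?F ?A realize = {p. keys p \<subseteq> lists {..<n} \<and> realize p = 0}"
    by (auto simp: a_kernel_def' free_algebra_def cliff_algebra_def)
  have realize_rel: "realize (rel i j :: nat list \<Rightarrow>\<^sub>0 'k) = 0" if "i < n" "j < n" for i j
  proof -
    have "realize (rel i j :: nat list \<Rightarrow>\<^sub>0 'k) = realize (vec [i, j]) - realize (lift (cliff_product \<delta> (e i) (e j)))"
      by (simp only: rel_def realize_def lin_ext_diff)
    also have "realize (lift (cliff_product \<delta> (e i) (e j)) :: nat list \<Rightarrow>\<^sub>0 'k) = cliff_product \<delta> (e i) (e j)"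
      by (rule realize_lift[OF cp])
    also have "realize (vec [i, j] :: nat list \<Rightarrow>\<^sub>0 'k) = cliff_product \<delta> (e i) (e j)"
      using realize_conc[of "vec [i]" "vec [j]"] that by (simp add: realize_gen)
    finally show ?thesis by simp
  qed
  have "a_kernel ?F ?A realize = genideal ?F R"
  proof
    have "R \<subseteq> a_kernel ?F ?A realize"
      unfolding ker R_def using rel_keys realize_rel by auto
    then show "genideal ?F R \<subseteq> a_kernel ?F ?A realize"
      using ring.genideal_minimal[OF F ring_hom_ring.kernel_is_ideal[OF hom]] by simp
    have "ideal (genideal ?F R) ?F"
      by (rule ring.genideal_ideal[OF F R])
    moreover have "rel i j \<in> genideal ?F R" if "i < n" "j < n" for i j
      using ring.genideal_self[OF F R] that by (auto simp: R_def)
    ultimately have "p - lift (realize p) \<in> genideal ?F R" if "keys p \<subseteq> lists {..<n}" for p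
      using that by (rule lift_realize_cong)
    then show "a_kernel ?F ?A realize \<subseteq> genideal ?F R"
      unfolding ker by (fastforce simp: lift_def)
  qed
  moreover have "realize ` carrier ?F = carrier ?A"
  proof
    show "realize ` carrier ?F \<subseteq> carrier ?A"
      using keys_realize by (auto simp: free_algebra_def cliff_algebra_def)
    show "carrier ?A \<subseteq> realize ` carrier ?F"
    proof
      fix p assume "p \<in> carrier ?A"
      then have p: "keys p \<subseteq> cliffs \<delta>" by (simp add: cliff_algebra_def)
      then show "p \<in> realize ` carrier ?F"
        by (intro image_eqI[of _ _ "lift p"]) (simp_all add: free_algebra_def realize_lift keys_lift)
    qed
  qed
  moreover have "finite R" by (simp add: R_def)
  ultimately show ?thesis
    unfolding finitely_presented_alg_def using realize_hom R by blast
qed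

end

lemma finite_cliffs_le: "finite {u \<in> cliffs \<delta>. u \<noteq> [] \<and> length u \<le> K}"
proof (rule finite_subset)
  show "{u \<in> cliffs \<delta>. u \<noteq> [] \<and> length u \<le> K} \<subseteq>
      {u. set u \<subseteq> {..\<Sum>i\<le>K. \<delta> i} \<and> length u \<le> K}"
  proof (intro subsetI CollectI conjI)
    fix u x assume u: "u \<in> {u \<in> cliffs \<delta>. u \<noteq> [] \<and> length u \<le> K}" and "x \<in> set u"
    then obtain i where i: "i < length u" "x = u ! i" by (metis in_set_conv_nth)
    with u have "x \<le> \<delta> (Suc i)" by (simp add: cliffs_iff)
    also have "\<dots> \<le> (\<Sum>i\<le>K. \<delta> i)"
      using i u by (intro member_le_sum) auto
    finally show "x \<in> {..\<Sum>i\<le>K. \<delta> i}" by simp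
  qed simp
qed (simp add: finite_lists_length_le)

text \<open>
  Choose \<open>K\<close> where \<open>\<delta>\<close> is least among the positions at which it is bounded by \<open>\<delta> 1\<close> for good. A larger
  value after \<open>K\<close> would make \<open>K\<close> the bottom of a valley that starts at position \<open>1\<close>.
\<close>

lemma eventually_constant_if_one_dominated:
  assumes vf: "valley_free \<delta>" and "one_dominated \<delta>"
  obtains K where "1 \<le> K" "\<And>j. K \<le> j \<Longrightarrow> \<delta> j = \<delta> K" "\<delta> K \<le> \<delta> 1"
proof -
  obtain k where k: "1 \<le> k" "\<And>j. k \<le> j \<Longrightarrow> \<delta> j \<le> \<delta> 1"
    using assms(2) unfolding one_dominated_def by blast
  define K where "K = (ARG_MIN \<delta> j. k < j)"
  have K: "k < K" and least: "\<And>j. k < j \<Longrightarrow> \<delta> K \<le> \<delta> j"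
    using arg_min_natI[of "\<lambda>j. k < j" "Suc k" \<delta>] arg_min_nat_le[of "\<lambda>j. k < j" _ \<delta>]
    unfolding K_def by auto
  show thesis
  proof
    show "1 \<le> K" "\<delta> K \<le> \<delta> 1" using k K by auto
    show "\<delta> j = \<delta> K" if "K \<le> j" for j
    proof (cases "j = K")
      case False
      then have "min (\<delta> 1) (\<delta> j) \<le> \<delta> K"
        using valley_freeD[OF vf, of 1 K j] k(1) K that by simp
      moreover have "\<delta> j \<le> \<delta> 1" "\<delta> K \<le> \<delta> j"
        using k(2)[of j] least[of j] K that by auto
      ultimately show ?thesis by simp
    qed simp
  qed
qed

lemma one_dominated_imp_finitely_presented:
  assumes vf: "valley_free \<delta>" and "one_dominated \<delta>"
  shows "finitely_presented_alg (cliff_algebra \<delta> :: ('k::field, nat list \<Rightarrow>\<^sub>0 'k) module)"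
proof -
  obtain K where K: "1 \<le> K" "\<And>j. K \<le> j \<Longrightarrow> \<delta> j = \<delta> K" "\<delta> K \<le> \<delta> 1"
    using eventually_constant_if_one_dominated[OF assms] by blast
  let ?G = "{u \<in> cliffs \<delta>. u \<noteq> [] \<and> length u \<le> K}"
  obtain e where e: "bij_betw e {0..<card ?G} ?G"
    using ex_bij_betw_nat_finite[OF finite_cliffs_le] by blast
  define idx where "idx = inv_into {0..<card ?G} e"
  have "eventually_constant \<delta> K (\<delta> K) (card ?G) e idx"
  proof
    show "e i \<in> cliffs \<delta> \<and> e i \<noteq> [] \<and> length (e i) \<le> K" if "i < card ?G" for i
      using bij_betwE[OF e] that by auto
    show "idx (e i) = i" if "i < card ?G" for i
      unfolding idx_def using that e by (intro bij_betw_inv_into_left) auto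
    show "idx u < card ?G \<and> e (idx u) = u" if "u \<in> cliffs \<delta>" "u \<noteq> []" "length u \<le> K" for u
    proof -
      have u: "u \<in> ?G" using that by simp
      show ?thesis
        using bij_betwE[OF bij_betw_inv_into[OF e]] u bij_betw_inv_into_right[OF e u]
        unfolding idx_def by auto
    qed
  next
    show "\<delta> j = \<delta> K" if "K \<le> j" for j using that by (rule K(2))
  qed (fact vf K)+
  then show ?thesis by (rule eventually_constant.finitely_presented)
qed

theorem proposition3p1p5:
  fixes \<delta> :: "nat \<Rightarrow> nat"
  assumes "valley_free \<delta>"
  shows "(free_alg (cliff_algebra \<delta> :: ('k::field_char_0, nat list \<Rightarrow>\<^sub>0 'k) module)
            \<longleftrightarrow> weakly_increasing \<delta>) \<and>
         (finitely_presented_alg (cliff_algebra \<delta> :: ('k, nat list \<Rightarrow>\<^sub>0 'k) module)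
            \<longleftrightarrow> one_dominated \<delta>)"
  using free_imp_weakly_increasing[OF assms] free_if_weakly_increasing[OF assms]
    finitely_presented_imp_one_dominated[OF assms] one_dominated_imp_finitely_presented[OF assms]
  by blast

end
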